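(* Let $\mathcal{D}$ be a linear monoidal category with a presentation $(X,E,R)_\otimes$ in which every generating morphism $e\in E$ is an endomorphism (i.e. $\partial_0e=\partial_1e$). Let $(M(X),\bar E,\bar R)$ be the following presentation of $\mathcal{D}$ as a linear category: (1) $M(X)$ is the free monoid on $X$, and $\bar E=\{(v,e,w)\mid v,w\in M(X),\ e\in E\}$, where for $e\colon x\to y$ the triple $(v,e,w)$ is an edge $vxw\to vyw$; (2) $\bar R=C\cup R'$, where $C$ consists of all morphisms $$(v,e,wv'y'w')\circ(vxwv',e',w')-(vywv',e',w')\circ(v,e,wv'x'w')$$ with $v,w,v',w'\in M(X)$ and $e\colon x\to y$, $e'\colon x'\to y'$ in $E$; and $R'$ consists of the following morphisms: for each relation in $R$, written (by choosing a representative $r$) as $[r]=\sum_{i=1}^n k_i[f_i]$ with $f_i=\alpha^i_1\circ\dots\circ\alpha^i_{n_i}$ and $\alpha^i_j=(v^i_j,e^i_j,w^i_j)$, and for all $a,b\in M(X)$, the morphism $r_{a,b}=\sum_{i=1}^nk_i(f_i)_{a,b}$, where $(f_i)_{a,b}=(\alpha^i_1)_{a,b}\circ\dots\circ(\alpha^i_{n_i})_{a,b}$ and $(\alpha^i_j)_{a,b}=(av^i_j,e^i_j,w^i_jb)$. For an object $a\in M(X)$, let $\bar E_a$ be the set of all generating morphisms in $\bar E$ that are endomorphisms of $a$, and let $\bar R_a$ be the set of all relations in $\bar R$ that are endomorphisms of $a$. Then the endomorphism algebra $\mathrm{End}_{\mathcal{D}}(a)$ (product given by composition) has the algebra presentation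 $$\mathrm{End}_{\mathcal{D}}(a)\cong\langle\bar E_a\mid\bar R_a\rangle,$$ i.e. it is isomorphic to the free associative unital $\Bbbk$-algebra on the set $\bar E_a$ modulo the two-sided ideal generated by $\bar R_a$.
   Context: $\Bbbk$ is a fixed commutative ground ring; all linear categories are small and $\Bbbk$-linear; all monoidal categories are strict. A quiver $Q=(V,E)$ is a set $V$ of vertices and a set $E$ of edges with start and end maps $\partial_0,\partial_1\colon E\to V$; write $e\colon a\to b$ if $\partial_0e=a$, $\partial_1e=b$. A path on $Q$ is a morphism of the free category on $Q$: a formal finite composition of composable edges, or a trivial path $1_v$, $v\in V$. A linear category is a category whose hom-sets are $\Bbbk$-modules and whose composition is bilinear. The free linear category $\mathscr{L}Q$ over $Q$ has object set $V$, and $\mathscr{L}Q(a,b)$ is the free $\Bbbk$-module on the paths from $a$ to $b$, with composition extended bilinearly. An ideal $\mathcal{I}$ of a linear category $\mathcal{L}$ is a family of submodules $\mathcal{I}(a,b)\subseteq\mathcal{L}(a,b)$, for all objects $a,b$, such that $g\circ f$ lies in $\mathcal{I}$ whenever $f$ and $g$ are composable morphisms of $\mathcal{L}$ and at least one of them lies in $\mathcal{I}$. For a set $S$ of morphisms, $\langle S\rangle$ is the smallest ideal containing $S$. The quotient category $\mathcal{L}/\mathcal{I}$ has the same objects and hom-modules $\mathcal{L}(a,b)/\mathcal{I}(a,b)$. A presentation of a linear category $\mathcal{C}$ is a triple $(V,E,R)$ with $(V,E)$ a quiver and $R$ a set of morphisms of $\mathscr{L}(V,E)$ such that $\mathcal{C}$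 is isomorphic, as a linear category, to $\mathscr{L}(V,E)/\langle R\rangle$. A (strict) linear monoidal category is a linear category with a bilinear bifunctor $\otimes$ which is strictly associative on objects and morphisms and has a strict unit object $\mathbb{1}$. A linear monoidal functor is a linear functor strictly preserving $\otimes$ and $\mathbb{1}$. A monoidal quiver is a quiver whose vertex set is a monoid; a morphism of monoidal quivers is a pair of maps on vertices and edges compatible with $\partial_0,\partial_1$ such that the map on vertices is a monoid morphism. Each linear monoidal category $\mathcal{D}$ has an underlying monoidal quiver $U\mathcal{D}$ (vertices: objects; edges: all morphisms). The free linear monoidal category $\mathscr{M}Q$ over a monoidal quiver $Q$, with a morphism of monoidal quivers $\tau\colon Q\to U\mathscr{M}Q$, is characterized by: for every linear monoidal category $\mathcal{D}$ and morphism of monoidal quivers $\phi\colon Q\to U\mathcal{D}$ there is a unique linear monoidal functor $\phi'\colon\mathscr{M}Q\to\mathcal{D}$ with $U\phi'\circ\tau=\phi$. For $Q=(M(X),E)$ it is realized as $\mathscr{L}\bar Q/\langle C\rangle$ with $\bar Q=(M(X),\bar E)$ and $\bar E$, $C$ as in the claim; $[f]$ denotes the class of a morphism $f$ of $\mathscr{L}\bar Q$. Its tensor product is concatenation on objects, and on morphisms it is the bilinear operation induced by: $1_a\otimes 1_b=1_{ab}$; $1_a\otimes(v,e,w)=(av,e,w)$ and $(v,e,w)\otimes 1_a=(v,e,wa)$; $1_a\otimes(\alpha_1\circ\dots\circ\alpha_n)=(1_a\otimes\alpha_1)\circ\dots\circ(1_a\otimes\alpha_n)$ and similarly for $-\otimes1_a$,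 the $\alpha_i$ being edges; and $f\otimes g=(f\otimes 1_d)\circ(1_a\otimes g)$ for paths $f\colon a\to b$, $g\colon c\to d$. The map $\tau$ is the identity on vertices and $\tau(e)=[(\mathbb{1},e,\mathbb{1})]$. A tensor ideal $\mathcal{I}$ of a linear monoidal category $\mathcal{D}$ is an ideal such that $f\otimes g$ lies in $\mathcal{I}$ whenever $f,g$ are morphisms of $\mathcal{D}$ and at least one of them lies in $\mathcal{I}$; $\langle R\rangle_\otimes$ is the smallest tensor ideal containing $R$. The quotient of $\mathcal{D}$ by a tensor ideal is the quotient linear category with $[f]\otimes[g]=[f\otimes g]$. A presentation of a linear monoidal category $\mathcal{D}$ is a triple $(X,E,R)_\otimes$, where $E$ is the edge set of a quiver $Q=(M(X),E)$ and $R$ is a set of morphisms of $\mathscr{M}Q$, such that $\mathcal{D}$ is isomorphic, as a linear monoidal category, to $\mathscr{M}Q/\langle R\rangle_\otimes$; the objects of $\mathcal{D}$ are identified with $M(X)$ via this isomorphism. Convention: if a path $f_i$ occurring in $r$ is trivial, $f_i=1_x$ (the case $n_i=0$), then $(f_i)_{a,b}=1_{axb}$. An element of $\bar R_a$ is a linear combination of compositions of elements of $\bar E_a$ and is read as an element of the free algebra on $\bar E_a$ (composition becoming product, $1_a$ becoming $1$). *)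

theory Defs
  imports "HOL-Algebra.QuotRing" "HOL-Algebra.Module" "Graph_Theory.Arc_Walk"
begin

section \<open>Linear categories\<close>

text \<open>Hom-sets are indexed by source and target and need not be disjoint, so the operations on
  morphisms take the objects as arguments: for \<open>g : b \<rightarrow> c\<close> and \<open>f : a \<rightarrow> b\<close>, the composite
  \<open>g \<circ> f : a \<rightarrow> c\<close> is \<open>comp_in C a b c g f\<close>. Of the library record of hom-modules only the module
  part is used; the fields \<open>mult\<close> and \<open>one\<close> of \<open>homs C a b\<close> carry no meaning.\<close>

record ('o, 'k, 'm) lincat =
  obj :: "'o set"
  homs :: "'o \<Rightarrow> 'o \<Rightarrow> ('k, 'm) module"
  ident :: "'o \<Rightarrow> 'm"
  comp_in :: "'o \<Rightarrow> 'o \<Rightarrow> 'o \<Rightarrow> 'm \<Rightarrow> 'm \<Rightarrow> 'm"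

abbreviation mor :: "('o, 'k, 'm, 'z) lincat_scheme \<Rightarrow> 'o \<Rightarrow> 'o \<Rightarrow> 'm set" where
  "mor C a b \<equiv> carrier (homs C a b)"

locale linear_category = K?: cring K
  for K :: "('k, 'y) ring_scheme" and C :: "('o, 'k, 'm, 'z) lincat_scheme" +
  assumes module_homs:
      "\<lbrakk>a \<in> obj C; b \<in> obj C\<rbrakk> \<Longrightarrow> Module.module K (homs C a b)"
    and ident_closed: "a \<in> obj C \<Longrightarrow> ident C a \<in> mor C a a"
    and comp_closed:
      "\<lbrakk>a \<in> obj C; b \<in> obj C; c \<in> obj C; g \<in> mor C b c; f \<in> mor C a b\<rbrakk> \<Longrightarrow>
       comp_in C a b c g f \<in> mor C a c"
    and comp_assoc:
      "\<lbrakk>a \<in> obj C; b \<in> obj C; c \<in> obj C; d \<in> obj C;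
        h \<in> mor C c d; g \<in> mor C b c; f \<in> mor C a b\<rbrakk> \<Longrightarrow>
       comp_in C a b d (comp_in C b c d h g) f = comp_in C a c d h (comp_in C a b c g f)"
    and comp_ident_left:
      "\<lbrakk>a \<in> obj C; b \<in> obj C; f \<in> mor C a b\<rbrakk> \<Longrightarrow> comp_in C a b b (ident C b) f = f"
    and comp_ident_right:
      "\<lbrakk>a \<in> obj C; b \<in> obj C; f \<in> mor C a b\<rbrakk> \<Longrightarrow> comp_in C a a b f (ident C a) = f"
    and comp_add_left:
      "\<lbrakk>a \<in> obj C; b \<in> obj C; c \<in> obj C; g \<in> mor C b c; g' \<in> mor C b c; f \<in> mor C a b\<rbrakk> \<Longrightarrow>
       comp_in C a b c (g \<oplus>\<^bsub>homs C b c\<^esub> g') f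
         = comp_in C a b c g f \<oplus>\<^bsub>homs C a c\<^esub> comp_in C a b c g' f"
    and comp_add_right:
      "\<lbrakk>a \<in> obj C; b \<in> obj C; c \<in> obj C; g \<in> mor C b c; f \<in> mor C a b; f' \<in> mor C a b\<rbrakk> \<Longrightarrow>
       comp_in C a b c g (f \<oplus>\<^bsub>homs C a b\<^esub> f')
         = comp_in C a b c g f \<oplus>\<^bsub>homs C a c\<^esub> comp_in C a b c g f'"
    and comp_smult_left:
      "\<lbrakk>a \<in> obj C; b \<in> obj C; c \<in> obj C; k \<in> carrier K; g \<in> mor C b c; f \<in> mor C a b\<rbrakk> \<Longrightarrow>
       comp_in C a b c (k \<odot>\<^bsub>homs C b c\<^esub> g) f = k \<odot>\<^bsub>homs C a c\<^esub> comp_in C a b c g f"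
    and comp_smult_right:
      "\<lbrakk>a \<in> obj C; b \<in> obj C; c \<in> obj C; k \<in> carrier K; g \<in> mor C b c; f \<in> mor C a b\<rbrakk> \<Longrightarrow>
       comp_in C a b c g (k \<odot>\<^bsub>homs C a b\<^esub> f) = k \<odot>\<^bsub>homs C a c\<^esub> comp_in C a b c g f"

definition End_alg :: "('o, 'k, 'm, 'z) lincat_scheme \<Rightarrow> 'o \<Rightarrow> ('k, 'm) module" where
  "End_alg C a = (homs C a a)\<lparr>mult := comp_in C a a a, one := ident C a\<rparr>"

text \<open>A set of morphisms is represented as a family of subsets of the hom-sets.\<close>

type_synonym ('o, 'm) mor_family = "'o \<Rightarrow> 'o \<Rightarrow> 'm set"

definition lin_ideal ::
  "('k, 'y) ring_scheme \<Rightarrow> ('o, 'k, 'm, 'z) lincat_scheme \<Rightarrow> ('o, 'm) mor_family \<Rightarrow> bool" where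
  "lin_ideal K C I \<longleftrightarrow>
     (\<forall>a \<in> obj C. \<forall>b \<in> obj C. submodule (I a b) K (homs C a b)) \<and>
     (\<forall>a \<in> obj C. \<forall>b \<in> obj C. \<forall>c \<in> obj C. \<forall>g \<in> mor C b c. \<forall>f \<in> mor C a b.
        g \<in> I b c \<or> f \<in> I a b \<longrightarrow> comp_in C a b c g f \<in> I a c)"

definition gen_ideal ::
  "('k, 'y) ring_scheme \<Rightarrow> ('o, 'k, 'm, 'z) lincat_scheme \<Rightarrow> ('o, 'm) mor_family \<Rightarrow>
   ('o, 'm) mor_family" where
  "gen_ideal K C S a b =
     \<Inter>{I a b | I. lin_ideal K C I \<and> (\<forall>x \<in> obj C. \<forall>y \<in> obj C. S x y \<subseteq> I x y)}"

text \<open>The library quotient \<open>M Quot N\<close> together with the scalar multiplication of cosets. For an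
  algebra \<open>M\<close> and a two-sided ideal \<open>N\<close> this is the quotient algebra; for a mere module it is the
  quotient module, with meaningless \<open>mult\<close> and \<open>one\<close>.\<close>

definition quot_module :: "('k, 'm) module \<Rightarrow> 'm set \<Rightarrow> ('k, 'm set) module" where
  "quot_module M N =
     ring.extend (M Quot N) (module.fields (\<lambda>k A. \<Union>x\<in>A. N +>\<^bsub>M\<^esub> (k \<odot>\<^bsub>M\<^esub> x)))"

definition lincat_quot ::
  "('o, 'k, 'm, 'z) lincat_scheme \<Rightarrow> ('o, 'm) mor_family \<Rightarrow> ('o, 'k, 'm set) lincat" where
  "lincat_quot C I =
     \<lparr>obj = obj C,
      homs = (\<lambda>a b. quot_module (homs C a b) (I a b)),
      ident = (\<lambda>a. I a a +>\<^bsub>homs C a a\<^esub> ident C a),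
      comp_in = (\<lambda>a b c A B. \<Union>g\<in>A. \<Union>f\<in>B. I a c +>\<^bsub>homs C a c\<^esub> comp_in C a b c g f)\<rparr>"

definition linear_functor ::
  "('k, 'y) ring_scheme \<Rightarrow> ('o, 'k, 'm, 'z) lincat_scheme \<Rightarrow> ('p, 'k, 'n, 'w) lincat_scheme \<Rightarrow>
   ('o \<Rightarrow> 'p) \<Rightarrow> ('o \<Rightarrow> 'o \<Rightarrow> 'm \<Rightarrow> 'n) \<Rightarrow> bool" where
  "linear_functor K C D Fo Fm \<longleftrightarrow>
     Fo \<in> obj C \<rightarrow> obj D \<and>
     (\<forall>a \<in> obj C. \<forall>b \<in> obj C.
        Fm a b \<in> hom (add_monoid (homs C a b)) (add_monoid (homs D (Fo a) (Fo b))) \<and>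
        (\<forall>k \<in> carrier K. \<forall>f \<in> mor C a b.
           Fm a b (k \<odot>\<^bsub>homs C a b\<^esub> f) = k \<odot>\<^bsub>homs D (Fo a) (Fo b)\<^esub> Fm a b f)) \<and>
     (\<forall>a \<in> obj C. Fm a a (ident C a) = ident D (Fo a)) \<and>
     (\<forall>a \<in> obj C. \<forall>b \<in> obj C. \<forall>c \<in> obj C. \<forall>g \<in> mor C b c. \<forall>f \<in> mor C a b.
        Fm a c (comp_in C a b c g f) = comp_in D (Fo a) (Fo b) (Fo c) (Fm b c g) (Fm a b f))"


section \<open>Strict linear monoidal categories\<close>

text \<open>For \<open>f : a \<rightarrow> b\<close> and \<open>g : c \<rightarrow> d\<close>, the morphism \<open>f \<otimes> g : ac \<rightarrow> bd\<close> is \<open>tens C a b c d f g\<close>.\<close>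

record ('o, 'k, 'm) moncat = "('o, 'k, 'm) lincat" +
  otens :: "'o \<Rightarrow> 'o \<Rightarrow> 'o"
  ounit :: "'o"
  tens :: "'o \<Rightarrow> 'o \<Rightarrow> 'o \<Rightarrow> 'o \<Rightarrow> 'm \<Rightarrow> 'm \<Rightarrow> 'm"

locale linear_monoidal_category = linear_category K C
  for K :: "('k, 'y) ring_scheme" and C :: "('o, 'k, 'm, 'z) moncat_scheme" +
  assumes monoid_obj: "Group.monoid \<lparr>carrier = obj C, mult = otens C, one = ounit C\<rparr>"
    and tens_closed:
      "\<lbrakk>a \<in> obj C; b \<in> obj C; c \<in> obj C; d \<in> obj C; f \<in> mor C a b; g \<in> mor C c d\<rbrakk> \<Longrightarrow>
       tens C a b c d f g \<in> mor C (otens C a c) (otens C b d)"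
    and tens_ident:
      "\<lbrakk>a \<in> obj C; b \<in> obj C\<rbrakk> \<Longrightarrow>
       tens C a a b b (ident C a) (ident C b) = ident C (otens C a b)"
    and tens_comp:
      "\<lbrakk>a \<in> obj C; b \<in> obj C; c \<in> obj C; a' \<in> obj C; b' \<in> obj C; c' \<in> obj C;
        g \<in> mor C b c; f \<in> mor C a b; g' \<in> mor C b' c'; f' \<in> mor C a' b'\<rbrakk> \<Longrightarrow>
       tens C a c a' c' (comp_in C a b c g f) (comp_in C a' b' c' g' f')
         = comp_in C (otens C a a') (otens C b b') (otens C c c')
             (tens C b c b' c' g g') (tens C a b a' b' f f')"
    and tens_add_left:
      "\<lbrakk>a \<in> obj C; b \<in> obj C; c \<in> obj C; d \<in> obj C;
        f \<in> mor C a b; f' \<in> mor C a b; g \<in> mor C c d\<rbrakk> \<Longrightarrow>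
       tens C a b c d (f \<oplus>\<^bsub>homs C a b\<^esub> f') g
         = tens C a b c d f g \<oplus>\<^bsub>homs C (otens C a c) (otens C b d)\<^esub> tens C a b c d f' g"
    and tens_add_right:
      "\<lbrakk>a \<in> obj C; b \<in> obj C; c \<in> obj C; d \<in> obj C;
        f \<in> mor C a b; g \<in> mor C c d; g' \<in> mor C c d\<rbrakk> \<Longrightarrow>
       tens C a b c d f (g \<oplus>\<^bsub>homs C c d\<^esub> g')
         = tens C a b c d f g \<oplus>\<^bsub>homs C (otens C a c) (otens C b d)\<^esub> tens C a b c d f g'"
    and tens_smult_left:
      "\<lbrakk>a \<in> obj C; b \<in> obj C; c \<in> obj C; d \<in> obj C;
        k \<in> carrier K; f \<in> mor C a b; g \<in> mor C c d\<rbrakk> \<Longrightarrow>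
       tens C a b c d (k \<odot>\<^bsub>homs C a b\<^esub> f) g
         = k \<odot>\<^bsub>homs C (otens C a c) (otens C b d)\<^esub> tens C a b c d f g"
    and tens_smult_right:
      "\<lbrakk>a \<in> obj C; b \<in> obj C; c \<in> obj C; d \<in> obj C;
        k \<in> carrier K; f \<in> mor C a b; g \<in> mor C c d\<rbrakk> \<Longrightarrow>
       tens C a b c d f (k \<odot>\<^bsub>homs C c d\<^esub> g)
         = k \<odot>\<^bsub>homs C (otens C a c) (otens C b d)\<^esub> tens C a b c d f g"
    and tens_assoc:
      "\<lbrakk>a \<in> obj C; b \<in> obj C; c \<in> obj C; d \<in> obj C; a' \<in> obj C; b' \<in> obj C;
        f \<in> mor C a b; g \<in> mor C c d; h \<in> mor C a' b'\<rbrakk> \<Longrightarrow>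
       tens C (otens C a c) (otens C b d) a' b' (tens C a b c d f g) h
         = tens C a b (otens C c a') (otens C d b') f (tens C c d a' b' g h)"
    and tens_unit_left:
      "\<lbrakk>a \<in> obj C; b \<in> obj C; f \<in> mor C a b\<rbrakk> \<Longrightarrow>
       tens C (ounit C) (ounit C) a b (ident C (ounit C)) f = f"
    and tens_unit_right:
      "\<lbrakk>a \<in> obj C; b \<in> obj C; f \<in> mor C a b\<rbrakk> \<Longrightarrow>
       tens C a b (ounit C) (ounit C) f (ident C (ounit C)) = f"

definition tensor_ideal ::
  "('k, 'y) ring_scheme \<Rightarrow> ('o, 'k, 'm, 'z) moncat_scheme \<Rightarrow> ('o, 'm) mor_family \<Rightarrow> bool" where
  "tensor_ideal K C I \<longleftrightarrow>
     lin_ideal K C I \<and>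
     (\<forall>a \<in> obj C. \<forall>b \<in> obj C. \<forall>c \<in> obj C. \<forall>d \<in> obj C. \<forall>f \<in> mor C a b. \<forall>g \<in> mor C c d.
        f \<in> I a b \<or> g \<in> I c d \<longrightarrow> tens C a b c d f g \<in> I (otens C a c) (otens C b d))"

definition gen_tensor_ideal ::
  "('k, 'y) ring_scheme \<Rightarrow> ('o, 'k, 'm, 'z) moncat_scheme \<Rightarrow> ('o, 'm) mor_family \<Rightarrow>
   ('o, 'm) mor_family" where
  "gen_tensor_ideal K C S a b =
     \<Inter>{I a b | I. tensor_ideal K C I \<and> (\<forall>x \<in> obj C. \<forall>y \<in> obj C. S x y \<subseteq> I x y)}"

definition moncat_quot ::
  "('o, 'k, 'm, 'z) moncat_scheme \<Rightarrow> ('o, 'm) mor_family \<Rightarrow> ('o, 'k, 'm set) moncat" where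
  "moncat_quot C I =
     lincat.extend (lincat_quot C I)
       (moncat.fields (otens C) (ounit C)
         (\<lambda>a b c d A B. \<Union>f\<in>A. \<Union>g\<in>B.
            I (otens C a c) (otens C b d)
              +>\<^bsub>homs C (otens C a c) (otens C b d)\<^esub> tens C a b c d f g))"

definition linear_monoidal_functor ::
  "('k, 'y) ring_scheme \<Rightarrow> ('o, 'k, 'm, 'z) moncat_scheme \<Rightarrow> ('p, 'k, 'n, 'w) moncat_scheme \<Rightarrow>
   ('o \<Rightarrow> 'p) \<Rightarrow> ('o \<Rightarrow> 'o \<Rightarrow> 'm \<Rightarrow> 'n) \<Rightarrow> bool" where
  "linear_monoidal_functor K C D Fo Fm \<longleftrightarrow>
     linear_functor K C D Fo Fm \<and>
     Fo (ounit C) = ounit D \<and>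
     (\<forall>a \<in> obj C. \<forall>b \<in> obj C. Fo (otens C a b) = otens D (Fo a) (Fo b)) \<and>
     (\<forall>a \<in> obj C. \<forall>b \<in> obj C. \<forall>c \<in> obj C. \<forall>d \<in> obj C. \<forall>f \<in> mor C a b. \<forall>g \<in> mor C c d.
        Fm (otens C a c) (otens C b d) (tens C a b c d f g)
          = tens D (Fo a) (Fo b) (Fo c) (Fo d) (Fm a b f) (Fm c d g))"

definition linear_monoidal_iso ::
  "('k, 'y) ring_scheme \<Rightarrow> ('o, 'k, 'm, 'z) moncat_scheme \<Rightarrow> ('p, 'k, 'n, 'w) moncat_scheme \<Rightarrow>
   ('o \<Rightarrow> 'p) \<Rightarrow> ('o \<Rightarrow> 'o \<Rightarrow> 'm \<Rightarrow> 'n) \<Rightarrow> bool" where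
  "linear_monoidal_iso K C D Fo Fm \<longleftrightarrow>
     linear_monoidal_functor K C D Fo Fm \<and>
     (\<exists>Go Gm. linear_monoidal_functor K D C Go Gm \<and>
        (\<forall>a \<in> obj C. Go (Fo a) = a) \<and>
        (\<forall>x \<in> obj D. Fo (Go x) = x) \<and>
        (\<forall>a \<in> obj C. \<forall>b \<in> obj C. \<forall>f \<in> mor C a b. Gm (Fo a) (Fo b) (Fm a b f) = f) \<and>
        (\<forall>x \<in> obj D. \<forall>y \<in> obj D. \<forall>h \<in> mor D x y. Fm (Go x) (Go y) (Gm x y h) = h))"


section \<open>Free modules, free algebras and free linear categories\<close>

definition free_module :: "('k, 'y) ring_scheme \<Rightarrow> 'b set \<Rightarrow> ('k, 'b \<Rightarrow> 'k) module" where
  "free_module K B =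
     \<lparr>carrier = {f. range f \<subseteq> carrier K \<and> finite {x. f x \<noteq> \<zero>\<^bsub>K\<^esub>} \<and> {x. f x \<noteq> \<zero>\<^bsub>K\<^esub>} \<subseteq> B},
      mult = undefined, one = undefined,
      zero = (\<lambda>_. \<zero>\<^bsub>K\<^esub>), add = (\<lambda>f g x. f x \<oplus>\<^bsub>K\<^esub> g x),
      smult = (\<lambda>k f x. k \<otimes>\<^bsub>K\<^esub> f x)\<rparr>"

definition basis_elem :: "('k, 'y) ring_scheme \<Rightarrow> 'b \<Rightarrow> 'b \<Rightarrow> 'k" where
  "basis_elem K p = (\<lambda>q. if q = p then \<one>\<^bsub>K\<^esub> else \<zero>\<^bsub>K\<^esub>)"

text \<open>The bilinear extension of concatenation of words, given by its coefficients.\<close>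

definition conv ::
  "('k, 'y) ring_scheme \<Rightarrow> ('b list \<Rightarrow> 'k) \<Rightarrow> ('b list \<Rightarrow> 'k) \<Rightarrow> 'b list \<Rightarrow> 'k" where
  "conv K g f = (\<lambda>w. finsum K (\<lambda>(p, q). g p \<otimes>\<^bsub>K\<^esub> f q) {(p, q). p @ q = w})"

definition free_algebra :: "('k, 'y) ring_scheme \<Rightarrow> 'b set \<Rightarrow> ('k, 'b list \<Rightarrow> 'k) module" where
  "free_algebra K B = (free_module K (lists B))\<lparr>mult := conv K, one := basis_elem K []\<rparr>"

definition presented_algebra ::
  "('k, 'y) ring_scheme \<Rightarrow> 'b set \<Rightarrow> ('b list \<Rightarrow> 'k) set \<Rightarrow> ('k, ('b list \<Rightarrow> 'k) set) module" where
  "presented_algebra K B S = quot_module (free_algebra K B) (Idl\<^bsub>free_algebra K B\<^esub> S)"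

definition algebra_iso ::
  "('k, 'y) ring_scheme \<Rightarrow> ('k, 'a) module \<Rightarrow> ('k, 'b) module \<Rightarrow> ('a \<Rightarrow> 'b) set" where
  "algebra_iso K A B =
     {h \<in> ring_iso A B. \<forall>k \<in> carrier K. \<forall>x \<in> carrier A. h (k \<odot>\<^bsub>A\<^esub> x) = k \<odot>\<^bsub>B\<^esub> h x}"

text \<open>Paths are written in composition order: the list \<open>[\<alpha>\<^sub>1, \<dots>, \<alpha>\<^sub>n]\<close> stands for
  \<open>\<alpha>\<^sub>1 \<circ> \<dots> \<circ> \<alpha>\<^sub>n\<close>, whereas library walks start with the edge that is traversed first. The empty list
  is the trivial path at any vertex; the ambiguity is harmless because hom-sets are indexed.\<close>

definition paths :: "('v, 'e) pre_digraph \<Rightarrow> 'v \<Rightarrow> 'v \<Rightarrow> 'e list set" where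
  "paths Q a b = {p. pre_digraph.awalk Q a (rev p) b}"

definition free_lincat ::
  "('k, 'y) ring_scheme \<Rightarrow> ('v, 'e) pre_digraph \<Rightarrow> ('v, 'k, 'e list \<Rightarrow> 'k) lincat" where
  "free_lincat K Q =
     \<lparr>obj = verts Q,
      homs = (\<lambda>a b. free_module K (paths Q a b)),
      ident = (\<lambda>a. basis_elem K []),
      comp_in = (\<lambda>a b c g f. conv K g f)\<rparr>"


section \<open>Free linear monoidal categories over quivers on a free monoid\<close>

text \<open>The free monoid on \<open>X\<close> is \<open>lists X\<close> under concatenation.\<close>

type_synonym ('x, 'e) bar_edge = "'x list \<times> 'e \<times> 'x list"

definition bar_quiver ::
  "('x list, 'e) pre_digraph \<Rightarrow> ('x list, ('x, 'e) bar_edge) pre_digraph" where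
  "bar_quiver Q =
     \<lparr>verts = verts Q,
      arcs = verts Q \<times> arcs Q \<times> verts Q,
      tail = (\<lambda>(v, e, w). v @ tail Q e @ w),
      head = (\<lambda>(v, e, w). v @ head Q e @ w)\<rparr>"

definition interchange_rels ::
  "('k, 'y) ring_scheme \<Rightarrow> ('x list, 'e) pre_digraph \<Rightarrow>
   ('x list, ('x, 'e) bar_edge list \<Rightarrow> 'k) mor_family" where
  "interchange_rels K Q a b =
     {r. \<exists>v \<in> verts Q. \<exists>w \<in> verts Q. \<exists>v' \<in> verts Q. \<exists>w' \<in> verts Q. \<exists>e \<in> arcs Q. \<exists>e' \<in> arcs Q.
        let x = tail Q e; y = head Q e; x' = tail Q e'; y' = head Q e' in
          a = v @ x @ w @ v' @ x' @ w' \<and> b = v @ y @ w @ v' @ y' @ w' \<and>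
          r = basis_elem K [(v, e, w @ v' @ y' @ w'), (v @ x @ w @ v', e', w')]
                \<ominus>\<^bsub>homs (free_lincat K (bar_quiver Q)) a b\<^esub>
              basis_elem K [(v @ y @ w @ v', e', w'), (v, e, w @ v' @ x' @ w')]}"

text \<open>\<open>whisker K a b f\<close> is \<open>1\<^sub>a \<otimes> f \<otimes> 1\<^sub>b\<close>, the linear extension of
  \<open>\<alpha>\<^sub>1 \<circ> \<dots> \<circ> \<alpha>\<^sub>n \<mapsto> (\<alpha>\<^sub>1)\<^sub>a\<^sub>,\<^sub>b \<circ> \<dots> \<circ> (\<alpha>\<^sub>n)\<^sub>a\<^sub>,\<^sub>b\<close>, given by its coefficients. Trivial paths go to trivial
  paths.\<close>

definition whisker_edge :: "'x list \<Rightarrow> 'x list \<Rightarrow> ('x, 'e) bar_edge \<Rightarrow> ('x, 'e) bar_edge" where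
  "whisker_edge a b = (\<lambda>(v, e, w). (a @ v, e, w @ b))"

definition whisker ::
  "('k, 'y) ring_scheme \<Rightarrow> 'x list \<Rightarrow> 'x list \<Rightarrow>
   (('x, 'e) bar_edge list \<Rightarrow> 'k) \<Rightarrow> ('x, 'e) bar_edge list \<Rightarrow> 'k" where
  "whisker K a b f = (\<lambda>q. finsum K f {p. map (whisker_edge a b) p = q})"

text \<open>On representatives \<open>f : a \<rightarrow> b\<close> and \<open>g : c \<rightarrow> d\<close> the tensor product is
  \<open>(f \<otimes> 1\<^sub>d) \<circ> (1\<^sub>a \<otimes> g)\<close>.\<close>

definition free_moncat ::
  "('k, 'y) ring_scheme \<Rightarrow> ('x list, 'e) pre_digraph \<Rightarrow>
   ('x list, 'k, (('x, 'e) bar_edge list \<Rightarrow> 'k) set) moncat" where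
  "free_moncat K Q =
     (let L = free_lincat K (bar_quiver Q); I = gen_ideal K L (interchange_rels K Q) in
      lincat.extend (lincat_quot L I)
        (moncat.fields (@) []
          (\<lambda>a b c d A B. \<Union>f\<in>A. \<Union>g\<in>B.
             I (a @ c) (b @ d) +>\<^bsub>homs L (a @ c) (b @ d)\<^esub>
               conv K (whisker K [] d f) (whisker K a [] g))))"

definition mor_class ::
  "('k, 'y) ring_scheme \<Rightarrow> ('x list, 'e) pre_digraph \<Rightarrow> 'x list \<Rightarrow> 'x list \<Rightarrow>
   (('x, 'e) bar_edge list \<Rightarrow> 'k) \<Rightarrow> (('x, 'e) bar_edge list \<Rightarrow> 'k) set" where
  "mor_class K Q a b f =
     gen_ideal K (free_lincat K (bar_quiver Q)) (interchange_rels K Q) a b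
       +>\<^bsub>homs (free_lincat K (bar_quiver Q)) a b\<^esub> f"

text \<open>The isomorphism \<open>(Fo, Fm)\<close> is part of the data, because it identifies the objects of \<open>D\<close> with
  the elements of the free monoid. The generating set is \<open>arcs Q\<close>.\<close>

definition monoidal_presentation ::
  "('k, 'y) ring_scheme \<Rightarrow> ('o, 'k, 'm, 'z) moncat_scheme \<Rightarrow>
   'x set \<Rightarrow> ('x list, 'e) pre_digraph \<Rightarrow>
   ('x list, (('x, 'e) bar_edge list \<Rightarrow> 'k) set) mor_family \<Rightarrow>
   ('x list \<Rightarrow> 'o) \<Rightarrow>
   ('x list \<Rightarrow> 'x list \<Rightarrow> (('x, 'e) bar_edge list \<Rightarrow> 'k) set set \<Rightarrow> 'm) \<Rightarrow> bool" where
  "monoidal_presentation K D X Q R Fo Fm \<longleftrightarrow>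
     wf_digraph Q \<and> verts Q = lists X \<and>
     (\<forall>a \<in> lists X. \<forall>b \<in> lists X. R a b \<subseteq> mor (free_moncat K Q) a b) \<and>
     linear_monoidal_iso K
       (moncat_quot (free_moncat K Q) (gen_tensor_ideal K (free_moncat K Q) R)) D Fo Fm"

text \<open>\<open>rep x y \<rho>\<close> is the chosen representative of the relation \<open>\<rho> : x \<rightarrow> y\<close>.\<close>

definition whiskered_rels ::
  "('k, 'y) ring_scheme \<Rightarrow> ('x list, 'e) pre_digraph \<Rightarrow>
   ('x list, (('x, 'e) bar_edge list \<Rightarrow> 'k) set) mor_family \<Rightarrow>
   ('x list \<Rightarrow> 'x list \<Rightarrow> (('x, 'e) bar_edge list \<Rightarrow> 'k) set \<Rightarrow> ('x, 'e) bar_edge list \<Rightarrow> 'k) \<Rightarrow>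
   ('x list, ('x, 'e) bar_edge list \<Rightarrow> 'k) mor_family" where
  "whiskered_rels K Q R rep c d =
     {whisker K a b (rep x y \<rho>) | a b x y \<rho>.
        a \<in> verts Q \<and> b \<in> verts Q \<and> x \<in> verts Q \<and> y \<in> verts Q \<and> \<rho> \<in> R x y \<and>
        c = a @ x @ b \<and> d = a @ y @ b}"

definition bar_rels ::
  "('k, 'y) ring_scheme \<Rightarrow> ('x list, 'e) pre_digraph \<Rightarrow>
   ('x list, (('x, 'e) bar_edge list \<Rightarrow> 'k) set) mor_family \<Rightarrow>
   ('x list \<Rightarrow> 'x list \<Rightarrow> (('x, 'e) bar_edge list \<Rightarrow> 'k) set \<Rightarrow> ('x, 'e) bar_edge list \<Rightarrow> 'k) \<Rightarrow>
   ('x list, ('x, 'e) bar_edge list \<Rightarrow> 'k) mor_family" where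
  "bar_rels K Q R rep c d = interchange_rels K Q c d \<union> whiskered_rels K Q R rep c d"

definition endo_arcs :: "('v, 'e) pre_digraph \<Rightarrow> 'v \<Rightarrow> 'e set" where
  "endo_arcs Q a = {\<alpha> \<in> arcs Q. tail Q \<alpha> = a \<and> head Q \<alpha> = a}"

end

theory Submission
  imports Defs
begin

text \<open>Write \<open>L\<close> for the free linear category on the quiver of edges \<open>(v, e, w)\<close>, \<open>I\<close> for the ideal of
  \<open>L\<close> generated by the interchange relations, \<open>M = L/I\<close> for the free linear monoidal category, \<open>J\<close>
  for the tensor ideal of \<open>M\<close> generated by \<open>R\<close>, and \<open>B\<close> for the ideal of \<open>L\<close> generated by the
  interchange relations together with all whiskered relations. The theorem is the combination of
  two facts.

  The first one holds for arbitrary edges: \<open>D\<close>, which is \<open>M/J\<close>, is also \<open>L/B\<close> as a linear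
  category. Whiskering \<open>f \<mapsto> 1\<^sub>a \<otimes> f \<otimes> 1\<^sub>b\<close> is a linear functor from \<open>L\<close> to itself which maps
  interchange relations to interchange relations and whiskered relations to whiskered relations;
  therefore it preserves \<open>I\<close> and \<open>B\<close> (lemmas \<open>whisker_I\<close> and \<open>whisker_B\<close>). As
  \<open>f \<otimes> g = (f \<otimes> 1) \<circ> (1 \<otimes> g)\<close>, closure under whiskering turns an ideal into a tensor ideal, so the
  image of \<open>B\<close> in \<open>M\<close> is a tensor ideal, and it contains \<open>R\<close>. Conversely, a tensor ideal that
  contains \<open>\<rho>\<close> contains \<open>1\<^sub>a \<otimes> \<rho> \<otimes> 1\<^sub>b\<close>, hence the image of \<open>B\<close> (lemma \<open>cls_B_in_tensor_ideal\<close>). So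
  \<open>J\<close> is the image of \<open>B\<close>, the composite functor \<open>L \<rightarrow> M \<rightarrow> M/J \<rightarrow> D\<close> is full with kernel \<open>B\<close>, and
  the first isomorphism theorem identifies the endomorphism algebra of an object \<open>a\<close> in \<open>D\<close> with
  \<open>L(a, a) / B(a, a)\<close> (lemma \<open>End_alg_iso_quot_B\<close>).

  The second one is where edges have to be endomorphisms. Then a path never leaves its starting
  point: \<open>L(a, a)\<close> is the free algebra on the edges at \<open>a\<close>, and \<open>L(a, b) = 0\<close> for \<open>a \<noteq> b\<close>. In
  general \<open>B(a, a)\<close> also contains composites \<open>a \<rightarrow> b \<rightarrow> b \<rightarrow> a\<close> with a relation in the middle; here
  these vanish for \<open>b \<noteq> a\<close>, so that \<open>B(a, a)\<close> is the two-sided ideal generated by the relations at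
  \<open>a\<close> (lemma \<open>gen_ideal_End_alg\<close>).\<close>

section \<open>Quotient modules\<close>

lemma quot_module_simps:
  "carrier (quot_module M N) = (\<lambda>x. N +>\<^bsub>M\<^esub> x) ` carrier M"
  "add (quot_module M N) = set_add M"
  "zero (quot_module M N) = N"
  "smult (quot_module M N) = (\<lambda>k A. \<Union>x\<in>A. N +>\<^bsub>M\<^esub> (k \<odot>\<^bsub>M\<^esub> x))"
  by (auto simp: quot_module_def ring.defs module.defs FactRing_def A_RCOSETS_def'
      a_r_coset_def')

locale quotient_module = Module.module K M
  for K :: "('k, 'y) ring_scheme" and M :: "('k, 'm) module" +
  fixes N :: "'m set"
  assumes submodule: "submodule N K M"
begin

lemma abelian_subgroup: "abelian_subgroup N M"
  using submodule abelian_subgroupI3[of N M] M.abelian_group_axioms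
  by (simp add: submodule_def additive_subgroup_def)

sublocale N: abelian_subgroup N M
  by (rule abelian_subgroup)

lemma coset_eq_iff:
  assumes "x \<in> carrier M" "y \<in> carrier M"
  shows "N +>\<^bsub>M\<^esub> x = N +>\<^bsub>M\<^esub> y \<longleftrightarrow> x \<ominus>\<^bsub>M\<^esub> y \<in> N"
  using N.a_rcos_module[of y x] N.a_repr_independence'[of x y] N.a_repr_independenceD[of y x]
    N.a_rcos_self[of x] assms
  by (auto simp: a_minus_def)

lemma coset_eq_zero_iff:
  assumes "x \<in> carrier M"
  shows "N +>\<^bsub>M\<^esub> x = N \<longleftrightarrow> x \<in> N"
proof -
  have minus_zero: "\<ominus>\<^bsub>M\<^esub> \<zero>\<^bsub>M\<^esub> = \<zero>\<^bsub>M\<^esub>" by (simp add: M.minus_equality)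
  have "x \<ominus>\<^bsub>M\<^esub> \<zero>\<^bsub>M\<^esub> = x" using assms by (simp add: a_minus_def minus_zero)
  then show ?thesis
    using coset_eq_iff[OF assms M.zero_closed] N.a_subset by simp
qed

lemma coset_memD:
  assumes "x \<in> carrier M" "y \<in> N +>\<^bsub>M\<^esub> x"
  shows "y \<in> carrier M" "N +>\<^bsub>M\<^esub> y = N +>\<^bsub>M\<^esub> x"
  using assms N.a_elemrcos_carrier N.a_repr_independence' by blast+

lemma coset_add:
  assumes "x \<in> carrier M" "y \<in> carrier M"
  shows "(N +>\<^bsub>M\<^esub> x) \<oplus>\<^bsub>quot_module M N\<^esub> (N +>\<^bsub>M\<^esub> y) = N +>\<^bsub>M\<^esub> (x \<oplus>\<^bsub>M\<^esub> y)"
  using assms by (simp add: quot_module_simps N.a_rcos_sum)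

lemma coset_smult:
  assumes k: "k \<in> carrier K" and x: "x \<in> carrier M"
  shows "k \<odot>\<^bsub>quot_module M N\<^esub> (N +>\<^bsub>M\<^esub> x) = N +>\<^bsub>M\<^esub> (k \<odot>\<^bsub>M\<^esub> x)"
proof -
  \<comment> \<open>The scalar multiplication of cosets is a union over representatives, all of whose members agree.\<close>
  have "N +>\<^bsub>M\<^esub> (k \<odot>\<^bsub>M\<^esub> y) = N +>\<^bsub>M\<^esub> (k \<odot>\<^bsub>M\<^esub> x)" if "y \<in> N +>\<^bsub>M\<^esub> x" for y
  proof -
    have y: "y \<in> carrier M" "y \<ominus>\<^bsub>M\<^esub> x \<in> N"
      using coset_memD[OF x that] coset_eq_iff[OF _ x] by auto
    have "(k \<odot>\<^bsub>M\<^esub> y) \<ominus>\<^bsub>M\<^esub> (k \<odot>\<^bsub>M\<^esub> x) = k \<odot>\<^bsub>M\<^esub> (y \<ominus>\<^bsub>M\<^esub> x)"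
      using k x y(1) by (simp add: a_minus_def smult_r_distr smult_r_minus)
    then show ?thesis
      using submodule.smult_closed[OF submodule k y(2)] coset_eq_iff k x y(1) by simp
  qed
  then show ?thesis
    unfolding quot_module_simps using N.a_rcos_self[OF x] by blast
qed

lemma module_quot_module: "Module.module K (quot_module M N)"
proof (rule moduleI[OF R.cring_axioms])
  note [simp] = coset_add coset_smult
  have z: "\<zero>\<^bsub>quot_module M N\<^esub> = N +>\<^bsub>M\<^esub> \<zero>\<^bsub>M\<^esub>"
    using coset_eq_zero_iff[OF M.zero_closed] by (simp add: quot_module_simps)
  show "abelian_group (quot_module M N)"
  proof (rule abelian_groupI)
    fix x assume "x \<in> carrier (quot_module M N)"
    then obtain u where "u \<in> carrier M" "x = N +>\<^bsub>M\<^esub> u" by (auto simp: quot_module_simps(1))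
    then show "\<exists>y\<in>carrier (quot_module M N). y \<oplus>\<^bsub>quot_module M N\<^esub> x = \<zero>\<^bsub>quot_module M N\<^esub>"
      by (intro bexI[of _ "N +>\<^bsub>M\<^esub> (\<ominus>\<^bsub>M\<^esub> u)"]) (auto simp: z M.l_neg quot_module_simps(1))
  qed (auto simp: z quot_module_simps(1) M.a_ac)
qed (auto simp: quot_module_simps(1) coset_add coset_smult smult_l_distr smult_r_distr smult_assoc1)

end

section \<open>Ideals and functors of linear categories\<close>

context linear_category
begin

lemma abelian_group_homs: "\<lbrakk>a \<in> obj C; b \<in> obj C\<rbrakk> \<Longrightarrow> abelian_group (homs C a b)"
  using module_homs by (simp add: Module.module_def)

lemma homs_add_closed [simp]:
  "\<lbrakk>a \<in> obj C; b \<in> obj C; f \<in> mor C a b; g \<in> mor C a b\<rbrakk> \<Longrightarrow> f \<oplus>\<^bsub>homs C a b\<^esub> g \<in> mor C a b"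
  by (rule abelian_monoid.a_closed[OF abelian_group.axioms(1)[OF abelian_group_homs]])

lemma homs_smult_closed [simp]:
  "\<lbrakk>a \<in> obj C; b \<in> obj C; k \<in> carrier K; f \<in> mor C a b\<rbrakk> \<Longrightarrow> k \<odot>\<^bsub>homs C a b\<^esub> f \<in> mor C a b"
  by (rule Module.module.smult_closed[OF module_homs])

lemma comp_zero_left:
  assumes "a \<in> obj C" "b \<in> obj C" "c \<in> obj C" "f \<in> mor C a b"
  shows "comp_in C a b c \<zero>\<^bsub>homs C b c\<^esub> f = \<zero>\<^bsub>homs C a c\<^esub>"
proof -
  interpret bc: abelian_group "homs C b c" using assms abelian_group_homs by blast
  interpret ac: abelian_group "homs C a c" using assms abelian_group_homs by blast
  let ?z = "comp_in C a b c \<zero>\<^bsub>homs C b c\<^esub> f"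
  have "?z \<oplus>\<^bsub>homs C a c\<^esub> ?z = ?z"
    using assms by (simp add: comp_add_left[symmetric])
  moreover have "?z \<in> mor C a c" using assms by (simp add: comp_closed)
  ultimately show ?thesis using ac.add.l_cancel_one[of ?z ?z] by simp
qed

lemma comp_zero_right:
  assumes "a \<in> obj C" "b \<in> obj C" "c \<in> obj C" "g \<in> mor C b c"
  shows "comp_in C a b c g \<zero>\<^bsub>homs C a b\<^esub> = \<zero>\<^bsub>homs C a c\<^esub>"
proof -
  interpret ab: abelian_group "homs C a b" using assms abelian_group_homs by blast
  interpret ac: abelian_group "homs C a c" using assms abelian_group_homs by blast
  let ?z = "comp_in C a b c g \<zero>\<^bsub>homs C a b\<^esub>"
  have "?z \<oplus>\<^bsub>homs C a c\<^esub> ?z = ?z"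
    using assms by (simp add: comp_add_right[symmetric])
  moreover have "?z \<in> mor C a c" using assms by (simp add: comp_closed)
  ultimately show ?thesis using ac.add.l_cancel_one[of ?z ?z] by simp
qed

lemma lin_ideal_full: "lin_ideal K C (mor C)"
  using Module.module.carrier_is_submodule[OF module_homs] comp_closed
  unfolding lin_ideal_def by simp

lemma lin_ideal_gen_ideal:
  assumes S: "\<And>x y. \<lbrakk>x \<in> obj C; y \<in> obj C\<rbrakk> \<Longrightarrow> S x y \<subseteq> mor C x y"
  shows "lin_ideal K C (gen_ideal K C S)"
proof -
  \<comment> \<open>\<open>gen_ideal\<close> intersects the family \<open>F\<close>; an empty intersection would be the set of all values
    of the type, so \<open>F\<close> has to be inhabited, namely by the ideal of all morphisms.\<close>
  define F where "F = {I. lin_ideal K C I \<and> (\<forall>x \<in> obj C. \<forall>y \<in> obj C. S x y \<subseteq> I x y)}"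
  have full: "mor C \<in> F" using S lin_ideal_full by (simp add: F_def)
  have mem: "f \<in> gen_ideal K C S a b \<longleftrightarrow> (\<forall>I\<in>F. f \<in> I a b)" for a b f
    unfolding gen_ideal_def F_def by auto
  have ideal: "lin_ideal K C I" if "I \<in> F" for I
    using that by (simp add: F_def)
  show ?thesis
    unfolding lin_ideal_def
  proof (intro conjI ballI)
    fix a b assume ab: "a \<in> obj C" "b \<in> obj C"
    interpret Module.module K "homs C a b" by (rule module_homs[OF ab])
    have sm: "submodule (I a b) K (homs C a b)" if "I \<in> F" for I
      using ideal[OF that] ab by (simp add: lin_ideal_def)
    show "submodule (gen_ideal K C S a b) K (homs C a b)"
    proof (rule submoduleI)
      show "gen_ideal K C S a b \<subseteq> mor C a b" using full mem by auto
      show "\<zero>\<^bsub>homs C a b\<^esub> \<in> gen_ideal K C S a b"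
        using subgroup.one_closed[OF submodule.axioms(1)[OF sm]] by (simp add: mem)
    qed (simp_all add: mem submoduleE(3-5)[OF sm])
  next
    fix a b c g f
    assume "a \<in> obj C" "b \<in> obj C" "c \<in> obj C" "g \<in> mor C b c" "f \<in> mor C a b"
    then show "g \<in> gen_ideal K C S b c \<or> f \<in> gen_ideal K C S a b \<longrightarrow>
        comp_in C a b c g f \<in> gen_ideal K C S a c"
      using ideal by (auto simp: mem lin_ideal_def)
  qed
qed

end

lemma gen_ideal_superset:
  "\<lbrakk>a \<in> obj C; b \<in> obj C\<rbrakk> \<Longrightarrow> S a b \<subseteq> gen_ideal K C S a b"
  unfolding gen_ideal_def by blast

lemma gen_ideal_least:
  assumes "lin_ideal K C I" "\<And>x y. \<lbrakk>x \<in> obj C; y \<in> obj C\<rbrakk> \<Longrightarrow> S x y \<subseteq> I x y"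
  shows "gen_ideal K C S a b \<subseteq> I a b"
  using assms unfolding gen_ideal_def by blast

lemma lin_idealD:
  assumes "lin_ideal K C I"
  shows "\<lbrakk>a \<in> obj C; b \<in> obj C\<rbrakk> \<Longrightarrow> submodule (I a b) K (homs C a b)"
    and "\<lbrakk>a \<in> obj C; b \<in> obj C; c \<in> obj C; g \<in> I b c; f \<in> mor C a b\<rbrakk> \<Longrightarrow> comp_in C a b c g f \<in> I a c"
    and "\<lbrakk>a \<in> obj C; b \<in> obj C; c \<in> obj C; g \<in> mor C b c; f \<in> I a b\<rbrakk> \<Longrightarrow> comp_in C a b c g f \<in> I a c"
    and "\<lbrakk>a \<in> obj C; b \<in> obj C\<rbrakk> \<Longrightarrow> I a b \<subseteq> mor C a b"
proof -
  show sm: "\<lbrakk>a \<in> obj C; b \<in> obj C\<rbrakk> \<Longrightarrow> submodule (I a b) K (homs C a b)" for a b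
    using assms unfolding lin_ideal_def by blast
  show sub: "\<lbrakk>a \<in> obj C; b \<in> obj C\<rbrakk> \<Longrightarrow> I a b \<subseteq> mor C a b" for a b
    using subgroup.subset[OF submodule.axioms(1)[OF sm]] by fastforce
  show "\<lbrakk>a \<in> obj C; b \<in> obj C; c \<in> obj C; g \<in> I b c; f \<in> mor C a b\<rbrakk> \<Longrightarrow> comp_in C a b c g f \<in> I a c"
    and "\<lbrakk>a \<in> obj C; b \<in> obj C; c \<in> obj C; g \<in> mor C b c; f \<in> I a b\<rbrakk> \<Longrightarrow> comp_in C a b c g f \<in> I a c"
    using assms sub unfolding lin_ideal_def by blast+
qed

lemma linear_functorD:
  assumes "linear_functor K C D Fo Fm"
  shows "a \<in> obj C \<Longrightarrow> Fo a \<in> obj D"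
    and "\<lbrakk>a \<in> obj C; b \<in> obj C; f \<in> mor C a b\<rbrakk> \<Longrightarrow> Fm a b f \<in> mor D (Fo a) (Fo b)"
    and "\<lbrakk>a \<in> obj C; b \<in> obj C; f \<in> mor C a b; f' \<in> mor C a b\<rbrakk> \<Longrightarrow>
      Fm a b (f \<oplus>\<^bsub>homs C a b\<^esub> f') = Fm a b f \<oplus>\<^bsub>homs D (Fo a) (Fo b)\<^esub> Fm a b f'"
    and "\<lbrakk>a \<in> obj C; b \<in> obj C; k \<in> carrier K; f \<in> mor C a b\<rbrakk> \<Longrightarrow>
      Fm a b (k \<odot>\<^bsub>homs C a b\<^esub> f) = k \<odot>\<^bsub>homs D (Fo a) (Fo b)\<^esub> Fm a b f"
    and "a \<in> obj C \<Longrightarrow> Fm a a (ident C a) = ident D (Fo a)"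
    and "\<lbrakk>a \<in> obj C; b \<in> obj C; c \<in> obj C; g \<in> mor C b c; f \<in> mor C a b\<rbrakk> \<Longrightarrow>
        Fm a c (comp_in C a b c g f) = comp_in D (Fo a) (Fo b) (Fo c) (Fm b c g) (Fm a b f)"
  using assms unfolding linear_functor_def hom_def by (auto simp: Pi_iff)

lemma linear_functorI:
  assumes "\<And>a. a \<in> obj C \<Longrightarrow> Fo a \<in> obj D"
    and "\<And>a b f. \<lbrakk>a \<in> obj C; b \<in> obj C; f \<in> mor C a b\<rbrakk> \<Longrightarrow> Fm a b f \<in> mor D (Fo a) (Fo b)"
    and "\<And>a b f f'. \<lbrakk>a \<in> obj C; b \<in> obj C; f \<in> mor C a b; f' \<in> mor C a b\<rbrakk> \<Longrightarrow>
      Fm a b (f \<oplus>\<^bsub>homs C a b\<^esub> f') = Fm a b f \<oplus>\<^bsub>homs D (Fo a) (Fo b)\<^esub> Fm a b f'"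
    and "\<And>a b k f. \<lbrakk>a \<in> obj C; b \<in> obj C; k \<in> carrier K; f \<in> mor C a b\<rbrakk> \<Longrightarrow>
      Fm a b (k \<odot>\<^bsub>homs C a b\<^esub> f) = k \<odot>\<^bsub>homs D (Fo a) (Fo b)\<^esub> Fm a b f"
    and "\<And>a. a \<in> obj C \<Longrightarrow> Fm a a (ident C a) = ident D (Fo a)"
    and "\<And>a b c g f. \<lbrakk>a \<in> obj C; b \<in> obj C; c \<in> obj C; g \<in> mor C b c; f \<in> mor C a b\<rbrakk> \<Longrightarrow>
        Fm a c (comp_in C a b c g f) = comp_in D (Fo a) (Fo b) (Fo c) (Fm b c g) (Fm a b f)"
  shows "linear_functor K C D Fo Fm"
  using assms unfolding linear_functor_def hom_def by auto

lemma linear_functor_comp: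
  assumes F: "linear_functor K C D Fo Fm" and G: "linear_functor K D E Go Gm"
  shows "linear_functor K C E (\<lambda>a. Go (Fo a)) (\<lambda>a b f. Gm (Fo a) (Fo b) (Fm a b f))"
  by (rule linear_functorI) (simp_all add: linear_functorD[OF F] linear_functorD[OF G])

lemma linear_functor_zero_minus:
  assumes C: "linear_category K C" and D: "linear_category K D"
    and F: "linear_functor K C D Fo Fm" and ab: "a \<in> obj C" "b \<in> obj C"
  shows "Fm a b \<zero>\<^bsub>homs C a b\<^esub> = \<zero>\<^bsub>homs D (Fo a) (Fo b)\<^esub>"
    and "f \<in> mor C a b \<Longrightarrow> Fm a b (\<ominus>\<^bsub>homs C a b\<^esub> f) = \<ominus>\<^bsub>homs D (Fo a) (Fo b)\<^esub> Fm a b f"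
    and "\<lbrakk>f \<in> mor C a b; g \<in> mor C a b\<rbrakk> \<Longrightarrow>
       Fm a b (f \<ominus>\<^bsub>homs C a b\<^esub> g) = Fm a b f \<ominus>\<^bsub>homs D (Fo a) (Fo b)\<^esub> Fm a b g"
proof -
  interpret C: linear_category K C by (rule C)
  interpret D: linear_category K D by (rule D)
  interpret abelian_group_hom "homs C a b" "homs D (Fo a) (Fo b)" "Fm a b"
    using F ab C.abelian_group_homs D.abelian_group_homs linear_functorD(1)[OF F]
    by (intro abelian_group_homI group_hom.intro group_hom_axioms.intro abelian_group.a_group)
       (auto simp: linear_functor_def)
  show "Fm a b \<zero>\<^bsub>homs C a b\<^esub> = \<zero>\<^bsub>homs D (Fo a) (Fo b)\<^esub>" by simp
  show *: "f \<in> mor C a b \<Longrightarrow> Fm a b (\<ominus>\<^bsub>homs C a b\<^esub> f) = \<ominus>\<^bsub>homs D (Fo a) (Fo b)\<^esub> Fm a b f" for f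
    by simp
  show "\<lbrakk>f \<in> mor C a b; g \<in> mor C a b\<rbrakk> \<Longrightarrow>
       Fm a b (f \<ominus>\<^bsub>homs C a b\<^esub> g) = Fm a b f \<ominus>\<^bsub>homs D (Fo a) (Fo b)\<^esub> Fm a b g"
    by (simp add: a_minus_def)
qed

lemma lin_ideal_preimage:
  assumes C: "linear_category K C" and D: "linear_category K D"
    and F: "linear_functor K C D Fo Fm" and I: "lin_ideal K D I"
  shows "lin_ideal K C (\<lambda>a b. {f \<in> mor C a b. Fm a b f \<in> I (Fo a) (Fo b)})"
proof -
  interpret C: linear_category K C by (rule C)
  interpret D: linear_category K D by (rule D)
  show ?thesis
    unfolding lin_ideal_def
  proof (intro conjI ballI impI)
    fix a b assume ab: "a \<in> obj C" "b \<in> obj C"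
    note ab' = ab[THEN linear_functorD(1)[OF F]]
    note E = Module.module.submoduleE[OF D.module_homs[OF ab'] lin_idealD(1)[OF I ab']]
    interpret Module.module K "homs C a b" by (rule C.module_homs[OF ab])
    have z: "\<zero>\<^bsub>homs D (Fo a) (Fo b)\<^esub> \<in> I (Fo a) (Fo b)"
      using subgroup.one_closed[OF submodule.axioms(1)[OF lin_idealD(1)[OF I ab']]] by simp
    show "submodule {f \<in> mor C a b. Fm a b f \<in> I (Fo a) (Fo b)} K (homs C a b)"
      by (rule submoduleI)
        (use E z ab in \<open>auto simp: linear_functor_zero_minus[OF C D F] linear_functorD[OF F]\<close>)
  next
    fix a b c g f
    assume "a \<in> obj C" "b \<in> obj C" "c \<in> obj C" "g \<in> mor C b c" "f \<in> mor C a b"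
      "g \<in> {f \<in> mor C b c. Fm b c f \<in> I (Fo b) (Fo c)} \<or> f \<in> {f \<in> mor C a b. Fm a b f \<in> I (Fo a) (Fo b)}"
    then show "comp_in C a b c g f \<in> {f \<in> mor C a c. Fm a c f \<in> I (Fo a) (Fo c)}"
      using lin_idealD(2,3)[OF I] by (auto simp: C.comp_closed linear_functorD[OF F])
  qed
qed

text \<open>The preimage of an ideal under a linear functor is an ideal, so generators suffice to check that
  a functor maps one ideal into another. Both the stability of ideals under whiskering and the
  comparison of ideals along \<open>L \<rightarrow> M\<close> rest on this.\<close>

lemma linear_functor_gen_ideal:
  assumes C: "linear_category K C" and D: "linear_category K D"
    and F: "linear_functor K C D Fo Fm" and I: "lin_ideal K D I"
    and S: "\<And>x y f. \<lbrakk>x \<in> obj C; y \<in> obj C; f \<in> S x y\<rbrakk> \<Longrightarrow> f \<in> mor C x y \<and> Fm x y f \<in> I (Fo x) (Fo y)"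
    and f: "f \<in> gen_ideal K C S a b"
  shows "Fm a b f \<in> I (Fo a) (Fo b)"
  using gen_ideal_least[OF lin_ideal_preimage[OF C D F I], of S a b] S f by blast

section \<open>Quotients of linear categories\<close>

lemma lincat_quot_simps:
  "obj (lincat_quot C I) = obj C"
  "homs (lincat_quot C I) a b = quot_module (homs C a b) (I a b)"
  "ident (lincat_quot C I) a = I a a +>\<^bsub>homs C a a\<^esub> ident C a"
  by (simp_all add: lincat_quot_def)

context linear_category
begin

lemma comp_minus:
  assumes abc: "a \<in> obj C" "b \<in> obj C" "c \<in> obj C"
    and g: "g \<in> mor C b c" "g' \<in> mor C b c" and f: "f \<in> mor C a b" "f' \<in> mor C a b"
  shows "comp_in C a b c g f \<ominus>\<^bsub>homs C a c\<^esub> comp_in C a b c g' f' =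
    comp_in C a b c (g \<ominus>\<^bsub>homs C b c\<^esub> g') f \<oplus>\<^bsub>homs C a c\<^esub>
    comp_in C a b c g' (f \<ominus>\<^bsub>homs C a b\<^esub> f')"
proof -
  interpret ab: abelian_group "homs C a b" using abc abelian_group_homs by blast
  interpret bc: abelian_group "homs C b c" using abc abelian_group_homs by blast
  interpret ac: abelian_group "homs C a c" using abc abelian_group_homs by blast
  have g'm: "comp_in C a b c g' (\<ominus>\<^bsub>homs C a b\<^esub> f') = \<ominus>\<^bsub>homs C a c\<^esub> comp_in C a b c g' f'"
  proof (rule ac.minus_equality[symmetric])
    show "comp_in C a b c g' (\<ominus>\<^bsub>homs C a b\<^esub> f') \<oplus>\<^bsub>homs C a c\<^esub> comp_in C a b c g' f' = \<zero>\<^bsub>homs C a c\<^esub>"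
      using abc f g by (simp add: comp_add_right[symmetric] ab.l_neg comp_zero_right)
  qed (use abc f g in \<open>auto simp: comp_closed\<close>)
  have gm: "comp_in C a b c (\<ominus>\<^bsub>homs C b c\<^esub> g') f = \<ominus>\<^bsub>homs C a c\<^esub> comp_in C a b c g' f"
  proof (rule ac.minus_equality[symmetric])
    show "comp_in C a b c (\<ominus>\<^bsub>homs C b c\<^esub> g') f \<oplus>\<^bsub>homs C a c\<^esub> comp_in C a b c g' f = \<zero>\<^bsub>homs C a c\<^esub>"
      using abc f g by (simp add: comp_add_left[symmetric] bc.l_neg comp_zero_left)
  qed (use abc f g in \<open>auto simp: comp_closed\<close>)
  show ?thesis
    unfolding a_minus_def using abc f g
    by (simp add: comp_add_left comp_add_right g'm gm comp_closed ac.a_assoc ac.r_neg1)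
qed

lemma quotient_module_homs:
  assumes "lin_ideal K C I" "a \<in> obj C" "b \<in> obj C"
  shows "quotient_module K (homs C a b) (I a b)"
  using assms module_homs lin_idealD(1)
  by (simp add: quotient_module_def quotient_module_axioms_def)

text \<open>By the decomposition in \<open>comp_minus\<close>, changing the representatives \<open>g\<close> and \<open>f\<close> by elements of \<open>I\<close>
  changes \<open>g \<circ> f\<close> by an element of \<open>I\<close>.\<close>

lemma quot_comp:
  assumes I: "lin_ideal K C I" and abc: "a \<in> obj C" "b \<in> obj C" "c \<in> obj C"
    and g: "g \<in> mor C b c" and f: "f \<in> mor C a b"
  shows "comp_in (lincat_quot C I) a b c (I b c +>\<^bsub>homs C b c\<^esub> g) (I a b +>\<^bsub>homs C a b\<^esub> f)
    = I a c +>\<^bsub>homs C a c\<^esub> comp_in C a b c g f"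
proof -
  interpret ab: quotient_module K "homs C a b" "I a b" by (rule quotient_module_homs[OF I abc(1,2)])
  interpret bc: quotient_module K "homs C b c" "I b c" by (rule quotient_module_homs[OF I abc(2,3)])
  interpret ac: quotient_module K "homs C a c" "I a c" by (rule quotient_module_homs[OF I abc(1,3)])
  have *: "I a c +>\<^bsub>homs C a c\<^esub> comp_in C a b c g' f' = I a c +>\<^bsub>homs C a c\<^esub> comp_in C a b c g f"
    if g': "g' \<in> I b c +>\<^bsub>homs C b c\<^esub> g" and f': "f' \<in> I a b +>\<^bsub>homs C a b\<^esub> f" for g' f'
  proof -
    have cl: "g' \<in> mor C b c" "f' \<in> mor C a b"
      by (rule bc.coset_memD(1)[OF g g'], rule ab.coset_memD(1)[OF f f'])
    have dg: "g' \<ominus>\<^bsub>homs C b c\<^esub> g \<in> I b c"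
      using bc.coset_memD(2)[OF g g'] bc.coset_eq_iff[OF cl(1) g] by simp
    have df: "f' \<ominus>\<^bsub>homs C a b\<^esub> f \<in> I a b"
      using ab.coset_memD(2)[OF f f'] ab.coset_eq_iff[OF cl(2) f] by simp
    have "comp_in C a b c g' f' \<ominus>\<^bsub>homs C a c\<^esub> comp_in C a b c g f \<in> I a c"
      unfolding comp_minus[OF abc cl(1) g cl(2) f]
      by (rule ac.N.a_closed[OF lin_idealD(2)[OF I abc dg cl(2)] lin_idealD(3)[OF I abc g df]])
    then show ?thesis
      using ac.coset_eq_iff[OF comp_closed[OF abc cl] comp_closed[OF abc g f]] by simp
  qed
  have "comp_in (lincat_quot C I) a b c (I b c +>\<^bsub>homs C b c\<^esub> g) (I a b +>\<^bsub>homs C a b\<^esub> f) =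
    (\<Union>g'\<in>I b c +>\<^bsub>homs C b c\<^esub> g. \<Union>f'\<in>I a b +>\<^bsub>homs C a b\<^esub> f.
       I a c +>\<^bsub>homs C a c\<^esub> comp_in C a b c g' f')"
    by (simp add: lincat_quot_def)
  also have "\<dots> = (\<Union>g'\<in>I b c +>\<^bsub>homs C b c\<^esub> g. \<Union>f'\<in>I a b +>\<^bsub>homs C a b\<^esub> f.
       I a c +>\<^bsub>homs C a c\<^esub> comp_in C a b c g f)"
    by (intro SUP_cong refl *)
  also have "\<dots> = I a c +>\<^bsub>homs C a c\<^esub> comp_in C a b c g f"
    using bc.N.a_rcos_self[OF g] ab.N.a_rcos_self[OF f] by auto
  finally show ?thesis .
qed

lemma linear_functor_quot:
  assumes I: "lin_ideal K C I"
  shows "linear_functor K C (lincat_quot C I) (\<lambda>a. a) (\<lambda>a b. (+>\<^bsub>homs C a b\<^esub>) (I a b))"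
  by (rule linear_functorI)
    (simp_all add: lincat_quot_simps quot_comp[OF I] quot_module_simps(1)
      quotient_module.coset_add[OF quotient_module_homs[OF I]]
      quotient_module.coset_smult[OF quotient_module_homs[OF I]])

text \<open>Every axiom descends along the projection, which is a functor and surjective on morphisms.\<close>

lemma linear_category_quot:
  assumes I: "lin_ideal K C I"
  shows "linear_category K (lincat_quot C I)"
proof -
  note F = linear_functor_quot[OF I]
  let ?Q = "lincat_quot C I"
  have rep: "\<exists>g\<in>mor C a b. f = I a b +>\<^bsub>homs C a b\<^esub> g" if "f \<in> mor ?Q a b" for f a b
    using that by (auto simp: lincat_quot_simps quot_module_simps)
  note cl = linear_functorD(2)[OF F]
  note S = linear_functorD(3-6)[OF F, symmetric]
  show ?thesis
  proof (intro linear_category.intro linear_category_axioms.intro K.cring_axioms, goal_cases)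
    case 1
    then show ?case
      by (simp add: lincat_quot_simps quotient_module.module_quot_module[OF quotient_module_homs[OF I]])
  next
    case (2 a)
    then show ?case using cl[of a a "ident C a"] by (simp add: lincat_quot_simps(1,3) ident_closed)
  next
    case (3 a b c g f)
    note A = this[unfolded lincat_quot_simps(1)]
    from A obtain g1 where g: "g1 \<in> mor C b c" "g = I b c +>\<^bsub>homs C b c\<^esub> g1"
      using rep by meson
    from A obtain f1 where f: "f1 \<in> mor C a b" "f = I a b +>\<^bsub>homs C a b\<^esub> f1"
      using rep by meson
    show ?case
      using A g f by (simp add: S cl comp_closed ident_closed comp_closed)
  next
    case (4 a b c d h g f)
    note A = this[unfolded lincat_quot_simps(1)]
    from A obtain h1 where h: "h1 \<in> mor C c d" "h = I c d +>\<^bsub>homs C c d\<^esub> h1"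
      using rep by meson
    from A obtain g1 where g: "g1 \<in> mor C b c" "g = I b c +>\<^bsub>homs C b c\<^esub> g1"
      using rep by meson
    from A obtain f1 where f: "f1 \<in> mor C a b" "f = I a b +>\<^bsub>homs C a b\<^esub> f1"
      using rep by meson
    show ?case
      using A h g f by (simp add: S cl comp_closed ident_closed comp_assoc)
  next
    case (5 a b f)
    note A = this[unfolded lincat_quot_simps(1)]
    from A obtain f1 where f: "f1 \<in> mor C a b" "f = I a b +>\<^bsub>homs C a b\<^esub> f1"
      using rep by meson
    show ?case
      using A f by (simp add: S cl comp_closed ident_closed comp_ident_left)
  next
    case (6 a b f)
    note A = this[unfolded lincat_quot_simps(1)]
    from A obtain f1 where f: "f1 \<in> mor C a b" "f = I a b +>\<^bsub>homs C a b\<^esub> f1"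
      using rep by meson
    show ?case
      using A f by (simp add: S cl comp_closed ident_closed comp_ident_right)
  next
    case (7 a b c g g' f)
    note A = this[unfolded lincat_quot_simps(1)]
    from A obtain g1 where g: "g1 \<in> mor C b c" "g = I b c +>\<^bsub>homs C b c\<^esub> g1"
      using rep by meson
    from A obtain g'1 where g': "g'1 \<in> mor C b c" "g' = I b c +>\<^bsub>homs C b c\<^esub> g'1"
      using rep by meson
    from A obtain f1 where f: "f1 \<in> mor C a b" "f = I a b +>\<^bsub>homs C a b\<^esub> f1"
      using rep by meson
    show ?case
      using A g g' f by (simp add: S cl comp_closed ident_closed comp_add_left)
  next
    case (8 a b c g f f')
    note A = this[unfolded lincat_quot_simps(1)]
    from A obtain g1 where g: "g1 \<in> mor C b c" "g = I b c +>\<^bsub>homs C b c\<^esub> g1"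
      using rep by meson
    from A obtain f1 where f: "f1 \<in> mor C a b" "f = I a b +>\<^bsub>homs C a b\<^esub> f1"
      using rep by meson
    from A obtain f'1 where f': "f'1 \<in> mor C a b" "f' = I a b +>\<^bsub>homs C a b\<^esub> f'1"
      using rep by meson
    show ?case
      using A g f f' by (simp add: S cl comp_closed ident_closed comp_add_right)
  next
    case (9 a b c k g f)
    note A = this[unfolded lincat_quot_simps(1)]
    from A obtain g1 where g: "g1 \<in> mor C b c" "g = I b c +>\<^bsub>homs C b c\<^esub> g1"
      using rep by meson
    from A obtain f1 where f: "f1 \<in> mor C a b" "f = I a b +>\<^bsub>homs C a b\<^esub> f1"
      using rep by meson
    show ?case
      using A g f by (simp add: S cl comp_closed ident_closed comp_smult_left)
  next
    case (10 a b c k g f)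
    note A = this[unfolded lincat_quot_simps(1)]
    from A obtain g1 where g: "g1 \<in> mor C b c" "g = I b c +>\<^bsub>homs C b c\<^esub> g1"
      using rep by meson
    from A obtain f1 where f: "f1 \<in> mor C a b" "f = I a b +>\<^bsub>homs C a b\<^esub> f1"
      using rep by meson
    show ?case
      using A g f by (simp add: S cl comp_closed ident_closed comp_smult_right)
  qed
qed


section \<open>Endomorphism algebras\<close>

lemma End_alg_simps:
  "carrier (End_alg C a) = mor C a a"
  "mult (End_alg C a) = comp_in C a a a"
  "one (End_alg C a) = ident C a"
  "zero (End_alg C a) = zero (homs C a a)"
  "add (End_alg C a) = add (homs C a a)"
  "smult (End_alg C a) = smult (homs C a a)"
  by (simp_all add: End_alg_def)

lemma ring_End_alg:
  assumes a: "a \<in> obj C"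
  shows "ring (End_alg C a)"
proof (rule ringI)
  interpret h: abelian_group "homs C a a" using a by (simp add: abelian_group_homs)
  show "abelian_group (End_alg C a)"
    by (rule abelian_groupI) (auto simp: End_alg_simps h.a_ac intro: bexI[of _ "\<ominus>\<^bsub>homs C a a\<^esub> _"] h.l_neg)
  show "Group.monoid (End_alg C a)"
    by (rule monoidI)
      (auto simp: End_alg_simps a ident_closed comp_closed comp_assoc comp_ident_left comp_ident_right)
qed (auto simp: End_alg_simps a comp_add_left comp_add_right)

text \<open>Ring ideals of an endomorphism algebra are automatically stable under scalars, because
  \<open>k \<odot> x = (k \<odot> 1) \<circ> x\<close>.\<close>

lemma ideal_End_alg_smult:
  assumes a: "a \<in> obj C" and J: "ideal J (End_alg C a)" and k: "k \<in> carrier K" and x: "x \<in> J"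
  shows "k \<odot>\<^bsub>homs C a a\<^esub> x \<in> J"
proof -
  interpret J: ideal J "End_alg C a" by (rule J)
  have xc: "x \<in> mor C a a" using J.a_Hcarr[OF x] by (simp add: End_alg_simps)
  have "comp_in C a a a (k \<odot>\<^bsub>homs C a a\<^esub> ident C a) x \<in> J"
    using J.I_l_closed[OF x, of "k \<odot>\<^bsub>homs C a a\<^esub> ident C a"] a k
    by (simp add: End_alg_simps ident_closed)
  then show ?thesis
    using a k xc by (simp add: comp_smult_left ident_closed comp_ident_left)
qed

lemma submodule_End_alg_ideal:
  assumes a: "a \<in> obj C" and J: "ideal J (End_alg C a)"
  shows "submodule J K (homs C a a)"
proof -
  interpret J: ideal J "End_alg C a" by (rule J)
  interpret h: Module.module K "homs C a a" using a by (simp add: module_homs)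
  have "subgroup J (add_monoid (homs C a a))"
    using J.a_subgroup by (simp add: End_alg_simps)
  then show ?thesis
    using ideal_End_alg_smult[OF a J] by (simp add: submodule_def submodule_axioms_def)
qed

lemma ideal_End_alg_lin_ideal:
  assumes I: "lin_ideal K C I" and a: "a \<in> obj C"
  shows "ideal (I a a) (End_alg C a)"
proof (rule idealI[OF ring_End_alg[OF a]])
  show "subgroup (I a a) (add_monoid (End_alg C a))"
    using submodule.axioms(1)[OF lin_idealD(1)[OF I a a]] by (simp add: End_alg_simps)
qed (use lin_idealD(2,3)[OF I] a in \<open>auto simp: End_alg_simps\<close>)

text \<open>If there are only zero morphisms between distinct objects, extending a two-sided ideal of the
  endomorphism algebra of \<open>a\<close> by all morphisms elsewhere yields an ideal of the category: a composite
  that starts and ends at \<open>a\<close> but passes through another object is zero. Hence at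
  \<open>a\<close> the ideal of the category is generated by the relations at \<open>a\<close> alone.\<close>

lemma gen_ideal_End_alg:
  assumes a: "a \<in> obj C"
    and S: "\<And>x y. \<lbrakk>x \<in> obj C; y \<in> obj C\<rbrakk> \<Longrightarrow> S x y \<subseteq> mor C x y"
    and disconnected: "\<And>x y. \<lbrakk>x \<in> obj C; y \<in> obj C; x \<noteq> y\<rbrakk> \<Longrightarrow> mor C x y = {\<zero>\<^bsub>homs C x y\<^esub>}"
  shows "gen_ideal K C S a a = Idl\<^bsub>End_alg C a\<^esub> (S a a)"
proof (rule equalityI)
  interpret E: ring "End_alg C a" by (rule ring_End_alg[OF a])
  have sub: "S a a \<subseteq> carrier (End_alg C a)" using S a by (simp add: End_alg_simps)
  let ?J = "Idl\<^bsub>End_alg C a\<^esub> (S a a)"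
  interpret J: ideal ?J "End_alg C a" by (rule E.genideal_ideal[OF sub])
  let ?I = "\<lambda>x y. if x = a \<and> y = a then ?J else mor C x y"
  have zJ: "\<zero>\<^bsub>homs C a a\<^esub> \<in> ?J" using J.zero_closed by (simp add: End_alg_simps)
  have "lin_ideal K C ?I"
    unfolding lin_ideal_def
  proof (intro conjI ballI impI)
    fix x y assume "x \<in> obj C" "y \<in> obj C"
    then show "submodule (?I x y) K (homs C x y)"
      using submodule_End_alg_ideal[OF a J.is_ideal] Module.module.carrier_is_submodule[OF module_homs]
      by auto
  next
    fix x y z g f
    assume xyz: "x \<in> obj C" "y \<in> obj C" "z \<in> obj C" and g: "g \<in> mor C y z" and f: "f \<in> mor C x y"
      and gf: "g \<in> ?I y z \<or> f \<in> ?I x y"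
    show "comp_in C x y z g f \<in> ?I x z"
    proof (cases "x = a \<and> z = a")
      case False
      then show ?thesis using xyz g f comp_closed by auto
    next
      case xz: True
      show ?thesis
      proof (cases "y = a")
        case True
        then show ?thesis
          using xz gf g f J.I_l_closed[of f g] J.I_r_closed[of g f] by (auto simp: End_alg_simps)
      next
        case False
        then have "g = \<zero>\<^bsub>homs C y z\<^esub>" using disconnected[of y z] xz xyz g by auto
        then show ?thesis using comp_zero_left[OF xyz f] xz zJ by simp
      qed
    qed
  qed
  moreover have "S x y \<subseteq> ?I x y" if "x \<in> obj C" "y \<in> obj C" for x y
    using S[OF that] E.genideal_self[OF sub] by auto
  ultimately show "gen_ideal K C S a a \<subseteq> ?J"
    using gen_ideal_least[of K C ?I S a a] by simp
next
  have "S a a \<subseteq> gen_ideal K C S a a" using a by (simp add: gen_ideal_superset)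
  then show "Idl\<^bsub>End_alg C a\<^esub> (S a a) \<subseteq> gen_ideal K C S a a"
    using ring.genideal_minimal[OF ring_End_alg[OF a]]
      ideal_End_alg_lin_ideal[OF lin_ideal_gen_ideal a] S by blast
qed

end

text \<open>The first isomorphism theorem for the map that a linear functor induces on endomorphism
  algebras. The isomorphism is the inverse of the ring isomorphism that sends the coset of \<open>f\<close> to
  \<open>Fm a a f\<close>; it remains to see that it respects scalars.\<close>

lemma End_alg_quot_iso:
  assumes C: "linear_category K C" and D: "linear_category K D"
    and F: "linear_functor K C D Fo Fm" and a: "a \<in> obj C" and I: "lin_ideal K C I"
    and full: "Fm a a ` mor C a a = mor D (Fo a) (Fo a)"
    and kernel: "\<And>f. f \<in> mor C a a \<Longrightarrow>
      Fm a a f = \<zero>\<^bsub>homs D (Fo a) (Fo a)\<^esub> \<longleftrightarrow> f \<in> I a a"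
  shows "algebra_iso K (End_alg D (Fo a)) (quot_module (End_alg C a) (I a a)) \<noteq> {}"
proof -
  interpret C: linear_category K C by (rule C)
  interpret D: linear_category K D by (rule D)
  note Fa = linear_functorD(1)[OF F a]
  let ?A = "End_alg C a" and ?B = "End_alg D (Fo a)" and ?N = "I a a"
  interpret A: ring ?A by (rule C.ring_End_alg[OF a])
  interpret B: ring ?B by (rule D.ring_End_alg[OF Fa])
  interpret N: ideal ?N ?A by (rule C.ideal_End_alg_lin_ideal[OF I a])
  interpret q: quotient_module K "homs C a a" ?N by (rule C.quotient_module_homs[OF I a a])
  note FD = linear_functorD[OF F]
  have "Fm a a \<in> ring_hom ?A ?B"
  proof (rule ring_hom_memI)
    fix x assume "x \<in> carrier ?A"
    then show "Fm a a x \<in> carrier ?B"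
      using FD(2)[OF a a] by (simp only: C.End_alg_simps D.End_alg_simps)
  next
    fix x y assume "x \<in> carrier ?A" "y \<in> carrier ?A"
    then have xy: "x \<in> mor C a a" "y \<in> mor C a a" by (simp_all only: C.End_alg_simps)
    show "Fm a a (x \<otimes>\<^bsub>?A\<^esub> y) = Fm a a x \<otimes>\<^bsub>?B\<^esub> Fm a a y"
      using FD(6)[OF a a a xy] by (simp only: C.End_alg_simps D.End_alg_simps)
    show "Fm a a (x \<oplus>\<^bsub>?A\<^esub> y) = Fm a a x \<oplus>\<^bsub>?B\<^esub> Fm a a y"
      using FD(3)[OF a a xy] by (simp only: C.End_alg_simps D.End_alg_simps)
  next
    show "Fm a a \<one>\<^bsub>?A\<^esub> = \<one>\<^bsub>?B\<^esub>"
      using FD(5)[OF a] by (simp only: C.End_alg_simps D.End_alg_simps)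
  qed
  then interpret h: ring_hom_ring ?A ?B "Fm a a"
    by (rule ring_hom_ringI2[OF A.ring_axioms B.ring_axioms])
  have ker: "a_kernel ?A ?B (Fm a a) = ?N"
    unfolding a_kernel_def' C.End_alg_simps D.End_alg_simps
    using kernel lin_idealD(4)[OF I a a] by fastforce
  let ?g = "\<lambda>U. the_elem (Fm a a ` U)"
  have g: "?g \<in> ring_iso (?A Quot ?N) ?B"
    using h.FactRing_iso_set full ker by (simp add: C.End_alg_simps D.End_alg_simps)
  have g_coset: "?g (?N +>\<^bsub>?A\<^esub> x) = Fm a a x" if "x \<in> carrier ?A" for x
    using h.the_elem_simp[OF that] ker by simp
  let ?Q = "quot_module ?A ?N"
  let ?h = "inv_into (carrier (?A Quot ?N)) ?g"
  have Q: "carrier ?Q = carrier (?A Quot ?N)" "mult ?Q = mult (?A Quot ?N)"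
    "one ?Q = one (?A Quot ?N)" "add ?Q = add (?A Quot ?N)"
    by (simp_all add: quot_module_def ring.defs)
  have "?h \<in> ring_iso ?B (?A Quot ?N)"
    by (rule ring_iso_set_sym[OF N.quotient_is_ring g])
  then have h: "?h \<in> ring_iso ?B ?Q"
    by (simp add: ring_iso_def ring_hom_def Q)
  have h_F: "?h (Fm a a x) = ?N +>\<^bsub>?A\<^esub> x" if "x \<in> carrier ?A" for x
  proof -
    have "inj_on ?g (carrier (?A Quot ?N))" using g by (simp add: ring_iso_def bij_betw_def)
    moreover have "?N +>\<^bsub>?A\<^esub> x \<in> carrier (?A Quot ?N)"
      using that by (simp add: Q(1)[symmetric] quot_module_simps)
    ultimately show ?thesis using inv_into_f_f[of ?g "carrier (?A Quot ?N)" "?N +>\<^bsub>?A\<^esub> x"] g_coset[OF that] by simp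
  qed
  have "?h (k \<odot>\<^bsub>?B\<^esub> y) = k \<odot>\<^bsub>?Q\<^esub> ?h y" if k: "k \<in> carrier K" and y: "y \<in> carrier ?B" for k y
  proof -
    obtain x where x: "x \<in> mor C a a" "y = Fm a a x"
      using y full by (auto simp: D.End_alg_simps)
    have "k \<odot>\<^bsub>?B\<^esub> y = Fm a a (k \<odot>\<^bsub>homs C a a\<^esub> x)"
      using k x a by (simp add: D.End_alg_simps linear_functorD[OF F])
    moreover have "?N +>\<^bsub>?A\<^esub> (k \<odot>\<^bsub>homs C a a\<^esub> x) = k \<odot>\<^bsub>?Q\<^esub> (?N +>\<^bsub>?A\<^esub> x)"
      using q.coset_smult[OF k x(1)]
      by (simp add: quot_module_simps a_r_coset_def' C.End_alg_simps)
    ultimately show ?thesis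
      using h_F x a k by (simp add: C.End_alg_simps)
  qed
  with h have "?h \<in> algebra_iso K ?B ?Q" unfolding algebra_iso_def by simp
  then show ?thesis by blast
qed

section \<open>Free modules and free linear categories\<close>

context cring
begin

lemma free_module_simps:
  "zero (free_module R B) = (\<lambda>_. \<zero>)"
  "add (free_module R B) = (\<lambda>f g x. f x \<oplus> g x)"
  "smult (free_module R B) = (\<lambda>k f x. k \<otimes> f x)"
  by (simp_all add: free_module_def)

lemma mem_free_module:
  "f \<in> carrier (free_module R B) \<longleftrightarrow>
     (\<forall>x. f x \<in> carrier R) \<and> finite {x. f x \<noteq> \<zero>} \<and> {x. f x \<noteq> \<zero>} \<subseteq> B"
  by (auto simp: free_module_def)

lemma free_module_closed: "f \<in> carrier (free_module R B) \<Longrightarrow> f x \<in> carrier R"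
  by (simp add: mem_free_module)

lemma basis_elem_mem: "p \<in> B \<Longrightarrow> basis_elem R p \<in> carrier (free_module R B)"
  by (auto simp: mem_free_module basis_elem_def)

lemma module_free_module: "Module.module R (free_module R B)"
proof (rule moduleI[OF cring_axioms])
  show "abelian_group (free_module R B)"
  proof (rule abelian_groupI)
    fix f g assume fg: "f \<in> carrier (free_module R B)" "g \<in> carrier (free_module R B)"
    have "{x. f x \<oplus> g x \<noteq> \<zero>} \<subseteq> {x. f x \<noteq> \<zero>} \<union> {x. g x \<noteq> \<zero>}" by auto
    with fg show "f \<oplus>\<^bsub>free_module R B\<^esub> g \<in> carrier (free_module R B)"
      by (auto simp: mem_free_module free_module_simps intro: finite_subset)
  next
    fix f assume f: "f \<in> carrier (free_module R B)"
    have "{x. \<ominus> f x \<noteq> \<zero>} \<subseteq> {x. f x \<noteq> \<zero>}" by auto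
    with f have "(\<lambda>x. \<ominus> f x) \<in> carrier (free_module R B)"
      by (auto simp: mem_free_module intro: finite_subset)
    then show "\<exists>g\<in>carrier (free_module R B). g \<oplus>\<^bsub>free_module R B\<^esub> f = \<zero>\<^bsub>free_module R B\<^esub>"
      by (rule rev_bexI) (use f in \<open>simp add: free_module_simps free_module_closed l_neg\<close>)
  qed (auto simp: free_module_simps mem_free_module a_ac)
next
  fix k f assume kf: "k \<in> carrier R" "f \<in> carrier (free_module R B)"
  then have "{x. k \<otimes> f x \<noteq> \<zero>} \<subseteq> {x. f x \<noteq> \<zero>}" by auto
  with kf show "k \<odot>\<^bsub>free_module R B\<^esub> f \<in> carrier (free_module R B)"
    by (auto simp: mem_free_module free_module_simps intro: finite_subset)
qed (auto simp: free_module_simps free_module_closed l_distr r_distr m_assoc)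

text \<open>Linear extension as an induction rule: an identity that is linear in \<open>f\<close> only needs to be verified
  on the basis. Associativity of \<open>conv\<close> and its compatibility with \<open>whisker\<close> are reduced in
  this way, argument by argument, to list identities.\<close>

lemma free_module_induct [consumes 1, case_names zero basis add smult]:
  assumes f: "f \<in> carrier (free_module R B)"
    and zero: "P (\<lambda>_. \<zero>)"
    and basis: "\<And>p. p \<in> B \<Longrightarrow> P (basis_elem R p)"
    and add: "\<And>f g. \<lbrakk>f \<in> carrier (free_module R B); g \<in> carrier (free_module R B); P f; P g\<rbrakk> \<Longrightarrow>
       P (\<lambda>x. f x \<oplus> g x)"
    and smult: "\<And>k f. \<lbrakk>k \<in> carrier R; f \<in> carrier (free_module R B); P f\<rbrakk> \<Longrightarrow>
       P (\<lambda>x. k \<otimes> f x)"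
  shows "P f"
proof -
  interpret F: Module.module R "free_module R B" by (rule module_free_module)
  have "P f" if "finite S" "f \<in> carrier (free_module R B)" "{x. f x \<noteq> \<zero>} \<subseteq> S" "S \<subseteq> B" for f S
    using that
  proof (induction S arbitrary: f rule: finite_induct)
    case empty
    then have "f = (\<lambda>_. \<zero>)" by auto
    then show ?case using zero by simp
  next
    case (insert p S)
    \<comment> \<open>Split off the coefficient at \<open>p\<close>, so that the remaining support lies in \<open>S\<close>.\<close>
    let ?g = "f(p := \<zero>)" and ?h = "\<lambda>x. f p \<otimes> basis_elem R p x"
    have p: "p \<in> B" and fp: "f p \<in> carrier R"
      using insert.prems by (auto simp: mem_free_module)
    have "{x. ?g x \<noteq> \<zero>} \<subseteq> {x. f x \<noteq> \<zero>}" by auto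
    then have g: "?g \<in> carrier (free_module R B)"
      using insert.prems by (auto simp: mem_free_module intro: finite_subset)
    have "P ?g" by (rule insert.IH[OF g]) (use insert.prems in auto)
    moreover have "P ?h" by (rule smult[OF fp basis_elem_mem[OF p] basis[OF p]])
    moreover have "?h \<in> carrier (free_module R B)"
      using F.smult_closed[OF fp basis_elem_mem[OF p]] by (simp add: free_module_simps)
    ultimately have "P (\<lambda>x. ?g x \<oplus> ?h x)" using g by (intro add)
    moreover have "(\<lambda>x. ?g x \<oplus> ?h x) = f"
      using insert.prems fp by (auto simp: basis_elem_def mem_free_module)
    ultimately show ?case by simp
  qed
  from this[of "{x. f x \<noteq> \<zero>}" f] show ?thesis using f by (simp add: mem_free_module)
qed

lemma finite_splits:
  fixes w :: "'c list"
  shows "finite {(p, q). p @ q = w}"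
proof -
  have "{(p, q). p @ q = w} \<subseteq> (\<lambda>i. (take i w, drop i w)) ` {..length w}"
  proof clarify
    fix p q :: "'c list"
    assume "w = p @ q"
    then show "(p, q) \<in> (\<lambda>i. (take i (p @ q), drop i (p @ q))) ` {..length (p @ q)}"
      by (intro image_eqI[of _ _ "length p"]) auto
  qed
  then show ?thesis by (rule finite_subset) simp
qed

lemma conv_zero:
  assumes "\<And>x. f x \<in> carrier R"
  shows "conv R (\<lambda>_. \<zero>) f = (\<lambda>_. \<zero>)" "conv R f (\<lambda>_. \<zero>) = (\<lambda>_. \<zero>)"
proof -
  have "(\<Oplus>u\<in>{(p, q). p @ q = w}. (\<lambda>(p, q). \<zero> \<otimes> f q) u) = (\<Oplus>u\<in>{(p, q). p @ q = w}. \<zero>)"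
    "(\<Oplus>u\<in>{(p, q). p @ q = w}. (\<lambda>(p, q). f p \<otimes> \<zero>) u) = (\<Oplus>u\<in>{(p, q). p @ q = w}. \<zero>)" for w
    using assms by (auto intro!: finsum_cong')
  then show "conv R (\<lambda>_. \<zero>) f = (\<lambda>_. \<zero>)" "conv R f (\<lambda>_. \<zero>) = (\<lambda>_. \<zero>)"
    by (auto simp: conv_def)
qed

lemma conv_add_left:
  assumes "\<And>x. f x \<in> carrier R" "\<And>x. g x \<in> carrier R" "\<And>x. h x \<in> carrier R"
  shows "conv R (\<lambda>x. f x \<oplus> g x) h = (\<lambda>x. conv R f h x \<oplus> conv R g h x)"
  unfolding conv_def using assms
  by (subst finsum_addf[symmetric]) (auto simp: l_distr intro!: finsum_cong')

lemma conv_add_right: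
  assumes "\<And>x. f x \<in> carrier R" "\<And>x. g x \<in> carrier R" "\<And>x. h x \<in> carrier R"
  shows "conv R h (\<lambda>x. f x \<oplus> g x) = (\<lambda>x. conv R h f x \<oplus> conv R h g x)"
  unfolding conv_def using assms
  by (subst finsum_addf[symmetric]) (auto simp: r_distr intro!: finsum_cong')

lemma conv_smult_left:
  assumes "k \<in> carrier R" "\<And>x. f x \<in> carrier R" "\<And>x. h x \<in> carrier R"
  shows "conv R (\<lambda>x. k \<otimes> f x) h = (\<lambda>x. k \<otimes> conv R f h x)"
  unfolding conv_def using assms finite_splits
  by (subst finsum_rdistr) (auto simp: m_assoc intro!: finsum_cong')

lemma conv_smult_right:
  assumes "k \<in> carrier R" "\<And>x. f x \<in> carrier R" "\<And>x. h x \<in> carrier R"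
  shows "conv R h (\<lambda>x. k \<otimes> f x) = (\<lambda>x. k \<otimes> conv R h f x)"
  unfolding conv_def using assms finite_splits
  by (subst finsum_rdistr) (auto simp: m_ac intro!: finsum_cong')

lemma conv_basis_elem:
  fixes p q :: "'c list"
  shows "conv R (basis_elem R p) (basis_elem R q) = basis_elem R (p @ q)"
proof
  fix w :: "'c list"
  let ?A = "{(p', q'). p' @ q' = w}"
  have eq: "conv R (basis_elem R p) (basis_elem R q) w =
    (\<Oplus>u\<in>?A. if (p, q) = u then \<one> else \<zero>)"
    unfolding conv_def by (rule finsum_cong') (auto simp: basis_elem_def split: if_splits)
  show "conv R (basis_elem R p) (basis_elem R q) w = basis_elem R (p @ q) w"
  proof (cases "w = p @ q")
    case True
    then show ?thesis
      unfolding eq using finsum_singleton[of "(p, q)" ?A "\<lambda>_. \<one>"]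
      by (simp add: basis_elem_def finite_splits)
  next
    case False
    then have "(\<Oplus>u\<in>?A. if (p, q) = u then \<one> else \<zero>) = (\<Oplus>u\<in>?A. \<zero>)"
      by (intro finsum_cong') auto
    then show ?thesis unfolding eq using False by (simp add: basis_elem_def)
  qed
qed

lemma conv_mem:
  assumes g: "g \<in> carrier (free_module R A)" and f: "f \<in> carrier (free_module R B)"
    and AB: "\<And>p q. \<lbrakk>p \<in> A; q \<in> B\<rbrakk> \<Longrightarrow> p @ q \<in> C"
  shows "conv R g f \<in> carrier (free_module R C)"
proof -
  interpret F: Module.module R "free_module R C" by (rule module_free_module)
  note cl = F.M.zero_closed[unfolded free_module_simps] F.M.a_closed[unfolded free_module_simps]
    F.smult_closed[unfolded free_module_simps]
  note c = free_module_closed[OF f] free_module_closed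
  from g show ?thesis
  proof (induction g rule: free_module_induct)
    case (basis p)
    have b: "basis_elem R p x \<in> carrier R" for x by (simp add: basis_elem_def)
    from f show ?case
      by (induction f rule: free_module_induct)
        (simp_all add: conv_zero conv_add_right conv_smult_right conv_basis_elem b
          free_module_closed cl basis AB basis_elem_mem)
  qed (simp_all add: conv_zero conv_add_left conv_smult_left c cl)
qed

lemma conv_ident:
  assumes f: "f \<in> carrier (free_module R B)"
  shows "conv R (basis_elem R []) f = f" "conv R f (basis_elem R []) = f"
proof -
  have b: "basis_elem R p x \<in> carrier R" for p :: "'c list" and x by (simp add: basis_elem_def)
  from f show "conv R (basis_elem R []) f = f"
    by (induction f rule: free_module_induct)
      (simp_all add: conv_zero conv_add_right conv_smult_right conv_basis_elem b free_module_closed)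
  from f show "conv R f (basis_elem R []) = f"
    by (induction f rule: free_module_induct)
      (simp_all add: conv_zero conv_add_left conv_smult_left conv_basis_elem b free_module_closed)
qed

lemma conv_assoc:
  assumes h: "h \<in> carrier (free_module R A)" and g: "g \<in> carrier (free_module R B)"
    and f: "f \<in> carrier (free_module R C)"
  shows "conv R (conv R h g) f = conv R h (conv R g f)"
proof -
  have cv: "conv R u v x \<in> carrier R"
    if "u \<in> carrier (free_module R A')" "v \<in> carrier (free_module R B')" for u v x A' B'
    using free_module_closed[OF conv_mem[OF that, of UNIV]] by simp
  have b: "basis_elem R p x \<in> carrier R" for p x by (simp add: basis_elem_def)
  have bm: "basis_elem R p \<in> carrier (free_module R UNIV)" for p by (simp add: basis_elem_mem)
  from h show ?thesis
  proof (induction h rule: free_module_induct)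
    case p: (basis p)
    from g show ?case
    proof (induction g rule: free_module_induct)
      case q: (basis q)
      from f show ?case
        by (induction f rule: free_module_induct)
          (simp_all add: conv_zero conv_add_right conv_smult_right conv_basis_elem b
            free_module_closed cv[OF bm])
    qed (simp_all add: conv_zero conv_add_left conv_add_right conv_smult_left conv_smult_right b
            free_module_closed free_module_closed[OF f] cv[OF bm] cv[OF _ f] f)
  qed (simp_all add: conv_zero conv_add_left conv_smult_left 
            free_module_closed free_module_closed[OF f] free_module_closed[OF g] cv[OF _ g] cv[OF g f])
qed

end

lemma free_lincat_simps:
  "obj (free_lincat K Q) = verts Q"
  "homs (free_lincat K Q) a b = free_module K (paths Q a b)"
  "ident (free_lincat K Q) a = basis_elem K []"
  "comp_in (free_lincat K Q) a b c g f = conv K g f"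
  by (simp_all add: free_lincat_def)

lemma (in wf_digraph) paths_append:
  "\<lbrakk>p \<in> paths G b c; q \<in> paths G a b\<rbrakk> \<Longrightarrow> p @ q \<in> paths G a c"
  by (simp add: paths_def)

lemma linear_category_free_lincat:
  assumes "cring K" "wf_digraph Q"
  shows "linear_category K (free_lincat K Q)"
proof -
  interpret cring K by fact
  interpret wf_digraph Q by fact
  show ?thesis
  proof (intro linear_category.intro linear_category_axioms.intro cring_axioms,
      unfold free_lincat_simps)
    fix a b c f g assume "g \<in> carrier (free_module K (paths Q b c))" "f \<in> carrier (free_module K (paths Q a b))"
    then show "conv K g f \<in> carrier (free_module K (paths Q a c))"
      using paths_append by (rule conv_mem)
  qed (auto simp: module_free_module conv_ident conv_assoc free_module_simps basis_elem_mem
      conv_add_left conv_add_right conv_smult_left conv_smult_right free_module_closed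
      paths_def awalk_Nil_iff)
qed

section \<open>Whiskering\<close>

lemma whisker_edge_simp [simp]: "whisker_edge a b (v, e, w) = (a @ v, e, w @ b)"
  by (simp add: whisker_edge_def)

lemma inj_map_whisker_edge: "inj (map (whisker_edge a b))"
  by (intro inj_mapI injI) (auto simp: whisker_edge_def)

lemma whisker_edge_whisker_edge: "whisker_edge a b (whisker_edge c d \<alpha>) = whisker_edge (a @ c) (d @ b) \<alpha>"
  by (simp add: whisker_edge_def split: prod.split)

context cring
begin

lemma whisker_map:
  assumes "f p \<in> carrier R"
  shows "whisker R a b f (map (whisker_edge a b) p) = f p"
proof -
  have "{p'. map (whisker_edge a b) p' = map (whisker_edge a b) p} = {p}"
    using injD[OF inj_map_whisker_edge] by blast
  then show ?thesis using assms by (simp add: whisker_def)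
qed

lemma whisker_outside:
  assumes "q \<notin> range (map (whisker_edge a b))"
  shows "whisker R a b f q = \<zero>"
proof -
  have "{p. map (whisker_edge a b) p = q} = {}" using assms by auto
  then show ?thesis by (simp add: whisker_def)
qed

text \<open>Whiskering of paths is injective, so the sum that defines a coefficient of \<open>whisker R a b f\<close> has at
  most one summand.\<close>

lemma whisker_eqI:
  assumes f: "\<And>x. f x \<in> carrier R"
    and g: "\<And>p. g (map (whisker_edge a b) p) = f p"
    and g0: "\<And>q. q \<notin> range (map (whisker_edge a b)) \<Longrightarrow> g q = \<zero>"
  shows "whisker R a b f = g"
proof
  fix q show "whisker R a b f q = g q"
  proof (cases "q \<in> range (map (whisker_edge a b))")
    case True
    then obtain p where "q = map (whisker_edge a b) p" by blast
    then show ?thesis using whisker_map[OF f] g by simp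
  next
    case False
    then show ?thesis by (simp add: whisker_outside g0)
  qed
qed

lemma whisker_zero: "whisker R a b (\<lambda>_. \<zero>) = (\<lambda>_. \<zero>)"
  by (rule whisker_eqI) auto

lemma whisker_add:
  assumes "\<And>x. f x \<in> carrier R" "\<And>x. g x \<in> carrier R"
  shows "whisker R a b (\<lambda>x. f x \<oplus> g x) = (\<lambda>x. whisker R a b f x \<oplus> whisker R a b g x)"
  by (rule whisker_eqI) (simp_all add: assms whisker_map whisker_outside)

lemma whisker_smult:
  assumes "k \<in> carrier R" "\<And>x. f x \<in> carrier R"
  shows "whisker R a b (\<lambda>x. k \<otimes> f x) = (\<lambda>x. k \<otimes> whisker R a b f x)"
  by (rule whisker_eqI) (simp_all add: assms whisker_map whisker_outside)

lemma whisker_basis_elem: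
  "whisker R a b (basis_elem R p) = basis_elem R (map (whisker_edge a b) p)"
  by (rule whisker_eqI) (auto simp: basis_elem_def inj_eq[OF inj_map_whisker_edge])

lemma whisker_mem:
  assumes f: "f \<in> carrier (free_module R A)"
    and AB: "\<And>p. p \<in> A \<Longrightarrow> map (whisker_edge a b) p \<in> B"
  shows "whisker R a b f \<in> carrier (free_module R B)"
proof -
  interpret F: Module.module R "free_module R B" by (rule module_free_module)
  note cl = F.M.zero_closed[unfolded free_module_simps] F.M.a_closed[unfolded free_module_simps]
    F.smult_closed[unfolded free_module_simps]
  from f show ?thesis
    by (induction f rule: free_module_induct)
      (simp_all add: whisker_zero whisker_add whisker_smult whisker_basis_elem
        free_module_closed cl AB basis_elem_mem)
qed

lemma whisker_closed:
  assumes "f \<in> carrier (free_module R A)"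
  shows "whisker R a b f x \<in> carrier R"
  using free_module_closed[OF whisker_mem[OF assms, of a b UNIV]] by simp

lemma whisker_conv:
  assumes g: "g \<in> carrier (free_module R A)" and f: "f \<in> carrier (free_module R B)"
  shows "whisker R a b (conv R g f) = conv R (whisker R a b g) (whisker R a b f)"
proof -
  have cv: "conv R u v x \<in> carrier R"
    if "u \<in> carrier (free_module R A')" "v \<in> carrier (free_module R B')" for u v x A' B'
    using free_module_closed[OF conv_mem[OF that, of UNIV]] by simp
  have b: "basis_elem R p x \<in> carrier R" for p x by (simp add: basis_elem_def)
  have bm: "basis_elem R p \<in> carrier (free_module R UNIV)" for p by (simp add: basis_elem_mem)
  from g show ?thesis
  proof (induction g rule: free_module_induct)
    case p: (basis p)
    from f show ?case
      by (induction f rule: free_module_induct)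
        (simp_all add: conv_zero whisker_zero conv_add_right whisker_add conv_smult_right
          whisker_smult conv_basis_elem whisker_basis_elem b free_module_closed cv[OF bm]
          whisker_closed)
  qed (simp_all add: conv_zero whisker_zero conv_add_left whisker_add conv_smult_left whisker_smult
      free_module_closed free_module_closed[OF f] cv[OF _ f] whisker_closed whisker_closed[OF f])
qed

lemma whisker_whisker:
  assumes "f \<in> carrier (free_module R A)"
  shows "whisker R a b (whisker R c d f) = whisker R (a @ c) (d @ b) f"
  using assms
  by (induction f rule: free_module_induct)
    (simp_all add: whisker_zero whisker_add whisker_smult whisker_basis_elem free_module_closed
      whisker_closed whisker_edge_whisker_edge comp_def)

lemma whisker_Nil:
  fixes f :: "('x, 'e) bar_edge list \<Rightarrow> 'a"
  assumes "\<And>x. f x \<in> carrier R"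
  shows "whisker R [] [] f = f"
proof (rule whisker_eqI[OF assms])
  have map_id: "map (whisker_edge [] []) p = p" for p :: "('x, 'e) bar_edge list"
    by (induction p) auto
  show "f (map (whisker_edge [] []) p) = f p" for p
    by (simp add: map_id)
  show "f q = \<zero>" if "q \<notin> range (map (whisker_edge [] []))" for q
    using that rangeI[of "map (whisker_edge [] [])" q] by (simp add: map_id)
qed

end

section \<open>The interchange ideal and whiskering\<close>

lemma bar_quiver_simps [simp]:
  "verts (bar_quiver Q) = verts Q"
  "arcs (bar_quiver Q) = verts Q \<times> arcs Q \<times> verts Q"
  "tail (bar_quiver Q) (v, e, w) = v @ tail Q e @ w"
  "head (bar_quiver Q) (v, e, w) = v @ head Q e @ w"
  by (simp_all add: bar_quiver_def)

locale free_monoid_quiver = K?: cring K + wf_digraph Q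
  for K :: "('k, 'y) ring_scheme" and Q :: "('x list, 'e) pre_digraph" +
  fixes X :: "'x set"
  assumes verts_Q: "verts Q = lists X"
begin

\<comment> \<open>Membership in the free monoid \<open>lists X\<close> stays atomic; only closure under concatenation is used.\<close>
declare in_lists_conv_set [simp del]

abbreviation L where "L \<equiv> free_lincat K (bar_quiver Q)"

lemma wf_bar_quiver: "wf_digraph (bar_quiver Q)"
proof
  fix \<alpha> assume "\<alpha> \<in> arcs (bar_quiver Q)"
  then obtain v e w where \<alpha>: "\<alpha> = (v, e, w)" "v \<in> lists X" "e \<in> arcs Q" "w \<in> lists X"
    by (auto simp: verts_Q)
  then show "tail (bar_quiver Q) \<alpha> \<in> verts (bar_quiver Q)" "head (bar_quiver Q) \<alpha> \<in> verts (bar_quiver Q)"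
    using wellformed[OF \<alpha>(3)] by (simp_all add: verts_Q)
qed

lemma linear_category_L: "linear_category K L"
  by (rule linear_category_free_lincat[OF cring_axioms wf_bar_quiver])

sublocale L: linear_category K L
  by (rule linear_category_L)

lemma obj_L: "obj L = lists X"
  by (simp add: free_lincat_simps verts_Q)

lemma whisker_paths:
  assumes ab: "a \<in> lists X" "b \<in> lists X" and p: "p \<in> paths (bar_quiver Q) x y"
  shows "map (whisker_edge a b) p \<in> paths (bar_quiver Q) (a @ x @ b) (a @ y @ b)"
proof -
  let ?w = "whisker_edge a b"
  have "pre_digraph.cas (bar_quiver Q) x es y \<Longrightarrow>
      pre_digraph.cas (bar_quiver Q) (a @ x @ b) (map ?w es) (a @ y @ b)" for es
  proof (induction es arbitrary: x)
    case Nil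
    then show ?case by (simp add: pre_digraph.cas.simps)
  next
    case (Cons \<alpha> es)
    obtain v e w where \<alpha>: "\<alpha> = (v, e, w)" by (cases \<alpha>)
    then show ?case
      using Cons.prems Cons.IH[of "head (bar_quiver Q) \<alpha>"] by (auto simp: pre_digraph.cas.simps)
  qed
  then show ?thesis
    using p ab
    by (fastforce simp: paths_def pre_digraph.awalk_def verts_Q rev_map)
qed

lemma linear_functor_whisker:
  assumes ab: "a \<in> lists X" "b \<in> lists X"
  shows "linear_functor K L L (\<lambda>x. a @ x @ b) (\<lambda>x y. whisker K a b)"
  by (rule linear_functorI)
    (use ab in \<open>auto simp: free_lincat_simps verts_Q whisker_paths whisker_mem free_module_simps
      whisker_add whisker_smult whisker_basis_elem whisker_conv free_module_closed\<close>)

abbreviation I where "I \<equiv> gen_ideal K L (interchange_rels K Q)"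

lemma interchange_relsE:
  assumes "r \<in> interchange_rels K Q x y"
  obtains v w v' w' e e' where
    "v \<in> lists X" "w \<in> lists X" "v' \<in> lists X" "w' \<in> lists X" "e \<in> arcs Q" "e' \<in> arcs Q"
    and "x = v @ tail Q e @ w @ v' @ tail Q e' @ w'" "y = v @ head Q e @ w @ v' @ head Q e' @ w'"
    and "r = basis_elem K [(v, e, w @ v' @ head Q e' @ w'), (v @ tail Q e @ w @ v', e', w')]
      \<ominus>\<^bsub>homs L x y\<^esub>
      basis_elem K [(v @ head Q e @ w @ v', e', w'), (v, e, w @ v' @ tail Q e' @ w')]"
  using assms unfolding interchange_rels_def Let_def verts_Q by blast

lemma interchange_relsI:
  assumes "v \<in> lists X" "w \<in> lists X" "v' \<in> lists X" "w' \<in> lists X" "e \<in> arcs Q" "e' \<in> arcs Q"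
    and "x = v @ tail Q e @ w @ v' @ tail Q e' @ w'" "y = v @ head Q e @ w @ v' @ head Q e' @ w'"
    and "r = basis_elem K [(v, e, w @ v' @ head Q e' @ w'), (v @ tail Q e @ w @ v', e', w')]
      \<ominus>\<^bsub>homs L x y\<^esub>
      basis_elem K [(v @ head Q e @ w @ v', e', w'), (v, e, w @ v' @ tail Q e' @ w')]"
  shows "r \<in> interchange_rels K Q x y"
  using assms unfolding interchange_rels_def Let_def verts_Q by blast

lemma interchange_basis_mor:
  assumes "v \<in> lists X" "w \<in> lists X" "v' \<in> lists X" "w' \<in> lists X" "e \<in> arcs Q" "e' \<in> arcs Q"
    and "x = v @ tail Q e @ w @ v' @ tail Q e' @ w'" "y = v @ head Q e @ w @ v' @ head Q e' @ w'"
  shows "basis_elem K [(v, e, w @ v' @ head Q e' @ w'), (v @ tail Q e @ w @ v', e', w')] \<in> mor L x y"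
    and "basis_elem K [(v @ head Q e @ w @ v', e', w'), (v, e, w @ v' @ tail Q e' @ w')] \<in> mor L x y"
  using assms wellformed[of e] wellformed[of e']
  by (simp_all add: free_lincat_simps basis_elem_mem paths_def pre_digraph.awalk_def
      pre_digraph.cas.simps verts_Q)

lemma interchange_rels_mor:
  assumes "x \<in> lists X" "y \<in> lists X" "r \<in> interchange_rels K Q x y"
  shows "r \<in> mor L x y"
proof -
  interpret h: abelian_group "homs L x y"
    by (rule L.abelian_group_homs) (simp_all only: obj_L assms)
  show ?thesis
    using assms(3)
  proof (rule interchange_relsE, goal_cases)
    case (1 v w v' w' e e')
    show ?case
      unfolding 1(9) by (rule h.minus_closed[OF interchange_basis_mor[OF 1(1-8)]])
  qed
qed

text \<open>Whiskering the interchange relation of \<open>(v, e, w, v', e', w')\<close> with \<open>a\<close> and \<open>b\<close> gives that of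
  \<open>(av, e, w, v', e', w'b)\<close>.\<close>

lemma whisker_interchange_rels:
  assumes ab: "a \<in> lists X" "b \<in> lists X" and xy: "x \<in> lists X" "y \<in> lists X"
    and r: "r \<in> interchange_rels K Q x y"
  shows "whisker K a b r \<in> interchange_rels K Q (a @ x @ b) (a @ y @ b)"
  using r
proof (rule interchange_relsE)
  fix v w v' w' e e'
  assume vw: "v \<in> lists X" "w \<in> lists X" "v' \<in> lists X" "w' \<in> lists X" "e \<in> arcs Q" "e' \<in> arcs Q"
    and x: "x = v @ tail Q e @ w @ v' @ tail Q e' @ w'"
    and y: "y = v @ head Q e @ w @ v' @ head Q e' @ w'"
    and r: "r = basis_elem K [(v, e, w @ v' @ head Q e' @ w'), (v @ tail Q e @ w @ v', e', w')]
      \<ominus>\<^bsub>homs L x y\<^esub>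
      basis_elem K [(v @ head Q e @ w @ v', e', w'), (v, e, w @ v' @ tail Q e' @ w')]"
  have xy': "x \<in> obj L" "y \<in> obj L" using xy by (simp_all only: obj_L)
  show ?thesis
  proof (rule interchange_relsI)
    show "whisker K a b r = basis_elem K [(a @ v, e, w @ v' @ head Q e' @ (w' @ b)), ((a @ v) @ tail Q e @ w @ v', e', w' @ b)]
      \<ominus>\<^bsub>homs L (a @ x @ b) (a @ y @ b)\<^esub>
      basis_elem K [((a @ v) @ head Q e @ w @ v', e', w' @ b), (a @ v, e, w @ v' @ tail Q e' @ (w' @ b))]"
      unfolding r linear_functor_zero_minus(3)[OF linear_category_L linear_category_L
          linear_functor_whisker[OF ab] xy' interchange_basis_mor[OF vw x y]]
      by (simp add: whisker_basis_elem)
  qed (use vw ab x y in \<open>simp_all\<close>)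
qed

lemma lin_ideal_I: "lin_ideal K L I"
  by (rule L.lin_ideal_gen_ideal) (auto simp only: obj_L intro: interchange_rels_mor)

lemma whisker_I:
  assumes ab: "a \<in> lists X" "b \<in> lists X" and f: "f \<in> I x y"
  shows "whisker K a b f \<in> I (a @ x @ b) (a @ y @ b)"
proof (rule linear_functor_gen_ideal[OF linear_category_L linear_category_L
      linear_functor_whisker[OF ab] lin_ideal_I _ f])
  fix x y f assume "x \<in> obj L" "y \<in> obj L" and f: "f \<in> interchange_rels K Q x y"
  then have xy: "x \<in> lists X" "y \<in> lists X" by (simp_all only: obj_L)
  have "a @ x @ b \<in> obj L" "a @ y @ b \<in> obj L"
    using ab xy by (simp_all add: obj_L)
  then show "f \<in> mor L x y \<and> whisker K a b f \<in> I (a @ x @ b) (a @ y @ b)"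
    using whisker_interchange_rels[OF ab xy f] interchange_rels_mor[OF xy f]
      gen_ideal_superset[of "a @ x @ b" L "a @ y @ b" "interchange_rels K Q" K] by auto
qed

end

section \<open>The tensor product of the free linear monoidal category\<close>

text \<open>Linear categories and linear functors only depend on the fields of the underlying \<open>lincat\<close>. The
  following two lemmas transport results about \<open>lincat_quot\<close> to its monoidal extensions.\<close>

lemma linear_category_cong:
  assumes "linear_category K C" "obj D = obj C" "homs D = homs C" "ident D = ident C"
    "comp_in D = comp_in C"
  shows "linear_category K D"
  using assms by (simp add: linear_category_def linear_category_axioms_def)

lemma linear_functor_cong:
  assumes "linear_functor K C D Fo Fm" "obj E = obj D" "homs E = homs D" "ident E = ident D"
    "comp_in E = comp_in D"
  shows "linear_functor K C E Fo Fm"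
  using assms by (simp add: linear_functor_def)

lemma moncat_quot_simps:
  "obj (moncat_quot C I) = obj (lincat_quot C I)"
  "homs (moncat_quot C I) = homs (lincat_quot C I)"
  "ident (moncat_quot C I) = ident (lincat_quot C I)"
  "comp_in (moncat_quot C I) = comp_in (lincat_quot C I)"
  by (simp_all add: moncat_quot_def lincat.defs)

text \<open>Fullness is what makes the image an ideal: a composite with an arbitrary morphism of \<open>D\<close> has to
  be lifted to \<open>C\<close>. The application is to the projection \<open>L \<rightarrow> M\<close>.\<close>

lemma lin_ideal_image:
  assumes C: "linear_category K C" and D: "linear_category K D"
    and F: "linear_functor K C D (\<lambda>a. a) Fm" and obj: "obj D = obj C"
    and full: "\<And>a b. \<lbrakk>a \<in> obj C; b \<in> obj C\<rbrakk> \<Longrightarrow> Fm a b ` mor C a b = mor D a b"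
    and I: "lin_ideal K C I"
  shows "lin_ideal K D (\<lambda>a b. Fm a b ` I a b)"
proof -
  interpret C: linear_category K C by (rule C)
  interpret D: linear_category K D by (rule D)
  note FD = linear_functorD[OF F] and Fz = linear_functor_zero_minus[OF C D F]
  note sub = lin_idealD(4)[OF I, THEN subsetD]
  show ?thesis
    unfolding lin_ideal_def obj
  proof (intro conjI ballI impI)
    fix a b assume ab: "a \<in> obj C" "b \<in> obj C"
    interpret c: Module.module K "homs C a b" by (rule C.module_homs[OF ab])
    interpret d: Module.module K "homs D a b" using ab obj by (intro D.module_homs) simp_all
    note E = c.submoduleE[OF lin_idealD(1)[OF I ab]]
    have zero: "\<zero>\<^bsub>homs C a b\<^esub> \<in> I a b"
      using subgroup.one_closed[OF submodule.axioms(1)[OF lin_idealD(1)[OF I ab]]] by simp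
    show "submodule (Fm a b ` I a b) K (homs D a b)"
    proof (rule d.submoduleI)
      show "Fm a b ` I a b \<subseteq> mor D a b" using FD(2)[OF ab] sub[OF ab] by auto
      show "\<zero>\<^bsub>homs D a b\<^esub> \<in> Fm a b ` I a b" using zero Fz(1)[OF ab] by (metis imageI)
    next
      fix u assume "u \<in> Fm a b ` I a b"
      then obtain x where x: "u = Fm a b x" "x \<in> I a b" by auto
      show "\<ominus>\<^bsub>homs D a b\<^esub> u \<in> Fm a b ` I a b"
        unfolding x(1) Fz(2)[OF ab sub[OF ab x(2)], symmetric] by (rule imageI[OF E(3)[OF x(2)]])
      fix v assume "v \<in> Fm a b ` I a b"
      then obtain y where y: "v = Fm a b y" "y \<in> I a b" by auto
      show "u \<oplus>\<^bsub>homs D a b\<^esub> v \<in> Fm a b ` I a b"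
        unfolding x(1) y(1) FD(3)[OF ab sub[OF ab x(2)] sub[OF ab y(2)], symmetric]
        by (rule imageI[OF E(5)[OF x(2) y(2)]])
    next
      fix k u assume k: "k \<in> carrier K" and "u \<in> Fm a b ` I a b"
      then obtain x where x: "u = Fm a b x" "x \<in> I a b" by auto
      show "k \<odot>\<^bsub>homs D a b\<^esub> u \<in> Fm a b ` I a b"
        unfolding x(1) FD(4)[OF ab k sub[OF ab x(2)], symmetric]
        by (rule imageI[OF E(4)[OF k x(2)]])
    qed
  next
    fix a b c g f
    assume abc: "a \<in> obj C" "b \<in> obj C" "c \<in> obj C" and "g \<in> mor D b c" "f \<in> mor D a b"
      and gf: "g \<in> Fm b c ` I b c \<or> f \<in> Fm a b ` I a b"
    then have g: "g \<in> Fm b c ` mor C b c" and f: "f \<in> Fm a b ` mor C a b"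
      using full by simp_all
    from gf show "comp_in D a b c g f \<in> Fm a c ` I a c"
    proof
      assume "g \<in> Fm b c ` I b c"
      then obtain y where y: "g = Fm b c y" "y \<in> I b c" by auto
      obtain x where x: "f = Fm a b x" "x \<in> mor C a b" using f by auto
      show ?thesis
        unfolding x(1) y(1) FD(6)[OF abc sub[OF abc(2,3) y(2)] x(2), symmetric]
        by (rule imageI[OF lin_idealD(2)[OF I abc y(2) x(2)]])
    next
      assume "f \<in> Fm a b ` I a b"
      then obtain x where x: "f = Fm a b x" "x \<in> I a b" by auto
      obtain y where y: "g = Fm b c y" "y \<in> mor C b c" using g by auto
      show ?thesis
        unfolding x(1) y(1) FD(6)[OF abc y(2) sub[OF abc(1,2) x(2)], symmetric]
        by (rule imageI[OF lin_idealD(3)[OF I abc y(2) x(2)]])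
    qed
  qed
qed

context free_monoid_quiver
begin

abbreviation M where "M \<equiv> free_moncat K Q"
abbreviation cls where "cls x y f \<equiv> I x y +>\<^bsub>homs L x y\<^esub> f"

lemma free_moncat_simps:
  "obj M = obj (lincat_quot L I)" "homs M = homs (lincat_quot L I)"
  "ident M = ident (lincat_quot L I)" "comp_in M = comp_in (lincat_quot L I)"
  "otens M = (@)" "ounit M = []"
  by (simp_all add: free_moncat_def Let_def lincat.defs moncat.defs)

lemma obj_M: "obj M = lists X"
  by (simp only: free_moncat_simps lincat_quot_simps obj_L)

lemma mor_M: "mor M x y = cls x y ` mor L x y"
  by (simp only: free_moncat_simps lincat_quot_simps quot_module_simps)

lemma linear_category_M: "linear_category K M"
  by (rule linear_category_cong[OF L.linear_category_quot[OF lin_ideal_I]])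
    (simp_all only: free_moncat_simps)

sublocale M: linear_category K M
  by (rule linear_category_M)

lemma linear_functor_cls: "linear_functor K L M (\<lambda>x. x) cls"
  by (rule linear_functor_cong[OF L.linear_functor_quot[OF lin_ideal_I]])
    (simp_all only: free_moncat_simps)

lemma quotient_module_I:
  assumes "x \<in> lists X" "y \<in> lists X"
  shows "quotient_module K (homs L x y) (I x y)"
  by (rule L.quotient_module_homs[OF lin_ideal_I]) (simp_all only: obj_L assms)

lemma cls_eq_iff:
  assumes "x \<in> lists X" "y \<in> lists X" "f \<in> mor L x y" "g \<in> mor L x y"
  shows "cls x y f = cls x y g \<longleftrightarrow> f \<ominus>\<^bsub>homs L x y\<^esub> g \<in> I x y"
  by (rule quotient_module.coset_eq_iff[OF quotient_module_I[OF assms(1,2)] assms(3,4)])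

lemma whisker_mor:
  assumes "a \<in> lists X" "b \<in> lists X" "x \<in> lists X" "y \<in> lists X" "f \<in> mor L x y"
  shows "whisker K a b f \<in> mor L (a @ x @ b) (a @ y @ b)"
  using linear_functorD(2)[OF linear_functor_whisker[OF assms(1,2)]] assms obj_L by simp

text \<open>As whiskering preserves \<open>I\<close>, it is well defined on classes.\<close>

lemma cls_whisker_eq:
  assumes ab: "a \<in> lists X" "b \<in> lists X" and xy: "x \<in> lists X" "y \<in> lists X"
    and f: "f \<in> mor L x y" and f': "f' \<in> cls x y f"
  shows "f' \<in> mor L x y"
    and "cls (a @ x @ b) (a @ y @ b) (whisker K a b f') = cls (a @ x @ b) (a @ y @ b) (whisker K a b f)"
proof -
  interpret q: quotient_module K "homs L x y" "I x y" by (rule quotient_module_I[OF xy])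
  show f'm: "f' \<in> mor L x y" by (rule q.coset_memD(1)[OF f f'])
  have xy': "x \<in> obj L" "y \<in> obj L" by (simp_all only: obj_L xy)
  have axb: "a @ x @ b \<in> lists X" "a @ y @ b \<in> lists X" using ab xy by simp_all
  have "f' \<ominus>\<^bsub>homs L x y\<^esub> f \<in> I x y"
    using q.coset_memD(2)[OF f f'] q.coset_eq_iff[OF f'm f] by simp
  then have "whisker K a b f' \<ominus>\<^bsub>homs L (a @ x @ b) (a @ y @ b)\<^esub> whisker K a b f
      \<in> I (a @ x @ b) (a @ y @ b)"
    unfolding linear_functor_zero_minus(3)[OF linear_category_L linear_category_L
        linear_functor_whisker[OF ab] xy' f'm f, symmetric]
    by (rule whisker_I[OF ab])
  then show "cls (a @ x @ b) (a @ y @ b) (whisker K a b f') =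
      cls (a @ x @ b) (a @ y @ b) (whisker K a b f)"
    by (subst cls_eq_iff[OF axb whisker_mor[OF ab xy f'm] whisker_mor[OF ab xy f]])
qed

text \<open>The tensor product of classes is a union over all representatives. Each member of the union is a
  composite of classes of whiskered morphisms, and these classes are independent of the
  representatives.\<close>

lemma tens_cls:
  assumes abcd: "a \<in> lists X" "b \<in> lists X" "c \<in> lists X" "d \<in> lists X"
    and f: "f \<in> mor L a b" and g: "g \<in> mor L c d"
  shows "tens M a b c d (cls a b f) (cls c d g) =
    cls (a @ c) (b @ d) (conv K (whisker K [] d f) (whisker K a [] g))"
proof -
  interpret ab: quotient_module K "homs L a b" "I a b" by (rule quotient_module_I[OF abcd(1,2)])
  interpret cd: quotient_module K "homs L c d" "I c d" by (rule quotient_module_I[OF abcd(3,4)])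
  have Nil: "[] \<in> lists X" by simp
  have ob: "a @ c \<in> obj L" "a @ d \<in> obj L" "b @ d \<in> obj L" using abcd by (simp_all add: obj_L)
  have cls_conv: "cls (a @ c) (b @ d) (conv K (whisker K [] d f') (whisker K a [] g')) =
    comp_in M (a @ c) (a @ d) (b @ d)
      (cls (a @ d) (b @ d) (whisker K [] d f')) (cls (a @ c) (a @ d) (whisker K a [] g'))"
    if f': "f' \<in> mor L a b" and g': "g' \<in> mor L c d" for f' g'
  proof -
    have "whisker K [] d f' \<in> mor L (a @ d) (b @ d)" "whisker K a [] g' \<in> mor L (a @ c) (a @ d)"
      using whisker_mor[OF Nil abcd(4) abcd(1,2) f'] whisker_mor[OF abcd(1) Nil abcd(3,4) g']
      by simp_all
    from L.quot_comp[OF lin_ideal_I ob this] show ?thesis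
      by (simp add: free_moncat_simps free_lincat_simps(4))
  qed
  have const: "cls (a @ c) (b @ d) (conv K (whisker K [] d f') (whisker K a [] g')) =
    cls (a @ c) (b @ d) (conv K (whisker K [] d f) (whisker K a [] g))"
    if f': "f' \<in> cls a b f" and g': "g' \<in> cls c d g" for f' g'
    unfolding cls_conv[OF cls_whisker_eq(1)[OF Nil abcd(4) abcd(1,2) f f']
        cls_whisker_eq(1)[OF abcd(1) Nil abcd(3,4) g g']] cls_conv[OF f g]
    using cls_whisker_eq(2)[OF Nil abcd(4) abcd(1,2) f f']
      cls_whisker_eq(2)[OF abcd(1) Nil abcd(3,4) g g'] by simp
  have "tens M a b c d (cls a b f) (cls c d g) = (\<Union>f'\<in>cls a b f. \<Union>g'\<in>cls c d g.
      cls (a @ c) (b @ d) (conv K (whisker K [] d f') (whisker K a [] g')))"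
    by (simp add: free_moncat_def Let_def lincat.defs moncat.defs)
  also have "\<dots> = (\<Union>f'\<in>cls a b f. \<Union>g'\<in>cls c d g.
      cls (a @ c) (b @ d) (conv K (whisker K [] d f) (whisker K a [] g)))"
    by (intro SUP_cong refl const)
  also have "\<dots> = cls (a @ c) (b @ d) (conv K (whisker K [] d f) (whisker K a [] g))"
    using ab.N.a_rcos_self[OF f] cd.N.a_rcos_self[OF g] by auto
  finally show ?thesis .
qed

end

section \<open>The tensor ideal of relations\<close>

lemma gen_tensor_ideal_least:
  assumes "tensor_ideal K C I" "\<And>x y. \<lbrakk>x \<in> obj C; y \<in> obj C\<rbrakk> \<Longrightarrow> S x y \<subseteq> I x y"
  shows "gen_tensor_ideal K C S a b \<subseteq> I a b"
  using assms unfolding gen_tensor_ideal_def by blast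

lemma gen_tensor_idealI:
  assumes "\<And>I. \<lbrakk>tensor_ideal K C I; \<And>x y. \<lbrakk>x \<in> obj C; y \<in> obj C\<rbrakk> \<Longrightarrow> S x y \<subseteq> I x y\<rbrakk> \<Longrightarrow> f \<in> I a b"
  shows "f \<in> gen_tensor_ideal K C S a b"
  using assms unfolding gen_tensor_ideal_def by auto

locale monoidal_relations = free_monoid_quiver K Q X
  for K :: "('k, 'y) ring_scheme" and Q :: "('x list, 'e) pre_digraph" and X :: "'x set" +
  fixes R :: "('x list, (('x, 'e) bar_edge list \<Rightarrow> 'k) set) mor_family"
    and rep :: "'x list \<Rightarrow> 'x list \<Rightarrow> (('x, 'e) bar_edge list \<Rightarrow> 'k) set \<Rightarrow>
                ('x, 'e) bar_edge list \<Rightarrow> 'k"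
  assumes rep_mor: "\<lbrakk>x \<in> lists X; y \<in> lists X; \<rho> \<in> R x y\<rbrakk> \<Longrightarrow> rep x y \<rho> \<in> mor L x y"
    and cls_rep: "\<lbrakk>x \<in> lists X; y \<in> lists X; \<rho> \<in> R x y\<rbrakk> \<Longrightarrow> cls x y (rep x y \<rho>) = \<rho>"
begin

abbreviation B where "B \<equiv> gen_ideal K L (bar_rels K Q R rep)"

lemma whiskered_relsE:
  assumes "r \<in> whiskered_rels K Q R rep c d"
  obtains a b x y \<rho> where "a \<in> lists X" "b \<in> lists X" "x \<in> lists X" "y \<in> lists X" "\<rho> \<in> R x y"
    "c = a @ x @ b" "d = a @ y @ b" "r = whisker K a b (rep x y \<rho>)"
  using assms unfolding whiskered_rels_def verts_Q by blast

lemma whiskered_relsI: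
  assumes "a \<in> lists X" "b \<in> lists X" "x \<in> lists X" "y \<in> lists X" "\<rho> \<in> R x y"
    "c = a @ x @ b" "d = a @ y @ b"
  shows "whisker K a b (rep x y \<rho>) \<in> whiskered_rels K Q R rep c d"
  using assms unfolding whiskered_rels_def verts_Q by blast

lemma bar_rels_mor:
  assumes "x \<in> lists X" "y \<in> lists X" "r \<in> bar_rels K Q R rep x y"
  shows "r \<in> mor L x y"
  using assms(3) unfolding bar_rels_def
proof
  assume "r \<in> interchange_rels K Q x y"
  then show ?thesis by (rule interchange_rels_mor[OF assms(1,2)])
next
  assume "r \<in> whiskered_rels K Q R rep x y"
  then show ?thesis
    by (rule whiskered_relsE) (simp add: whisker_mor rep_mor)
qed

lemma lin_ideal_B: "lin_ideal K L B"
  by (rule L.lin_ideal_gen_ideal) (auto simp only: obj_L intro: bar_rels_mor)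

lemma bar_rels_B:
  "\<lbrakk>x \<in> lists X; y \<in> lists X; r \<in> bar_rels K Q R rep x y\<rbrakk> \<Longrightarrow> r \<in> B x y"
  using gen_ideal_superset[of x L y "bar_rels K Q R rep" K] by (auto simp only: obj_L)

lemma I_subset_B: "I x y \<subseteq> B x y"
  by (rule gen_ideal_least[OF lin_ideal_B]) (auto simp only: obj_L bar_rels_def intro: bar_rels_B)

text \<open>Whiskering twice is whiskering by the products: \<open>1\<^sub>a \<otimes> (1\<^sub>c \<otimes> \<rho> \<otimes> 1\<^sub>d) \<otimes> 1\<^sub>b\<close> is the relation
  \<open>\<rho>\<close> whiskered by \<open>ac\<close> and \<open>db\<close>.\<close>

lemma whisker_bar_rels:
  assumes ab: "a \<in> lists X" "b \<in> lists X" and xy: "x \<in> lists X" "y \<in> lists X"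
    and r: "r \<in> bar_rels K Q R rep x y"
  shows "whisker K a b r \<in> bar_rels K Q R rep (a @ x @ b) (a @ y @ b)"
  using r unfolding bar_rels_def
proof
  assume "r \<in> interchange_rels K Q x y"
  then show "whisker K a b r \<in> interchange_rels K Q (a @ x @ b) (a @ y @ b) \<union>
      whiskered_rels K Q R rep (a @ x @ b) (a @ y @ b)"
    by (intro UnI1 whisker_interchange_rels[OF ab xy])
next
  assume "r \<in> whiskered_rels K Q R rep x y"
  then show "whisker K a b r \<in> interchange_rels K Q (a @ x @ b) (a @ y @ b) \<union>
      whiskered_rels K Q R rep (a @ x @ b) (a @ y @ b)"
  proof (intro UnI2, elim whiskered_relsE)
    fix c d u v \<rho>
    assume cd: "c \<in> lists X" "d \<in> lists X" and uv: "u \<in> lists X" "v \<in> lists X" "\<rho> \<in> R u v"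
      and x: "x = c @ u @ d" and y: "y = c @ v @ d" and r: "r = whisker K c d (rep u v \<rho>)"
    have "whisker K a b r = whisker K (a @ c) (d @ b) (rep u v \<rho>)"
      unfolding r using rep_mor[OF uv] by (intro whisker_whisker) (simp add: free_lincat_simps)
    moreover have "whisker K (a @ c) (d @ b) (rep u v \<rho>)
        \<in> whiskered_rels K Q R rep (a @ x @ b) (a @ y @ b)"
      using ab cd uv x y by (intro whiskered_relsI) simp_all
    ultimately show "whisker K a b r \<in> whiskered_rels K Q R rep (a @ x @ b) (a @ y @ b)"
      by simp
  qed
qed

lemma whisker_B:
  assumes ab: "a \<in> lists X" "b \<in> lists X" and f: "f \<in> B x y"
  shows "whisker K a b f \<in> B (a @ x @ b) (a @ y @ b)"
proof (rule linear_functor_gen_ideal[OF linear_category_L linear_category_L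
      linear_functor_whisker[OF ab] lin_ideal_B _ f])
  fix x y f assume "x \<in> obj L" "y \<in> obj L" and f: "f \<in> bar_rels K Q R rep x y"
  then have xy: "x \<in> lists X" "y \<in> lists X" by (simp_all only: obj_L)
  then have "a @ x @ b \<in> lists X" "a @ y @ b \<in> lists X" using ab by simp_all
  from bar_rels_B[OF this whisker_bar_rels[OF ab xy f]]
  show "f \<in> mor L x y \<and> whisker K a b f \<in> B (a @ x @ b) (a @ y @ b)"
    using bar_rels_mor[OF xy f] by simp
qed

text \<open>\<open>B\<close> is an ideal that is stable under whiskering, and \<open>f \<otimes> g\<close> is a composite of whiskered morphisms
  one of which lies in \<open>B\<close> if \<open>f\<close> or \<open>g\<close> does.\<close>

lemma tensor_ideal_cls_B: "tensor_ideal K M (\<lambda>x y. cls x y ` B x y)"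
  unfolding tensor_ideal_def
proof (intro conjI ballI impI)
  show "lin_ideal K M (\<lambda>x y. cls x y ` B x y)"
    by (rule lin_ideal_image[OF linear_category_L linear_category_M linear_functor_cls _ _ lin_ideal_B])
      (simp_all only: obj_M obj_L mor_M)
next
  fix a b c d f g
  assume "a \<in> obj M" "b \<in> obj M" "c \<in> obj M" "d \<in> obj M"
    and fg: "f \<in> mor M a b" "g \<in> mor M c d" "f \<in> cls a b ` B a b \<or> g \<in> cls c d ` B c d"
  then have abcd: "a \<in> lists X" "b \<in> lists X" "c \<in> lists X" "d \<in> lists X"
    by (simp_all only: obj_M)
  have Nil: "[] \<in> lists X" by simp
  have ob: "a @ c \<in> obj L" "a @ d \<in> obj L" "b @ d \<in> obj L" using abcd by (simp_all add: obj_L)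
  have sub: "h \<in> mor L x y" if "x \<in> lists X" "y \<in> lists X" "h \<in> B x y" for h x y
    using lin_idealD(4)[OF lin_ideal_B, of x y] that by (auto simp only: obj_L)
  obtain f' g' where f': "f' \<in> mor L a b" "f = cls a b f'" and g': "g' \<in> mor L c d" "g = cls c d g'"
    and B: "f' \<in> B a b \<or> g' \<in> B c d"
    using fg sub[OF abcd(1,2)] sub[OF abcd(3,4)] unfolding mor_M by blast
  have Wf: "whisker K [] d f' \<in> mor L (a @ d) (b @ d)"
    using whisker_mor[OF Nil abcd(4) abcd(1,2) f'(1)] by simp
  have Wg: "whisker K a [] g' \<in> mor L (a @ c) (a @ d)"
    using whisker_mor[OF abcd(1) Nil abcd(3,4) g'(1)] by simp
  have "conv K (whisker K [] d f') (whisker K a [] g') \<in> B (a @ c) (b @ d)"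
    using B
  proof
    assume "f' \<in> B a b"
    then have "whisker K [] d f' \<in> B (a @ d) (b @ d)"
      using whisker_B[OF Nil abcd(4), of f' a b] by simp
    from lin_idealD(2)[OF lin_ideal_B ob this Wg] show ?thesis
      by (simp add: free_lincat_simps(4))
  next
    assume "g' \<in> B c d"
    then have "whisker K a [] g' \<in> B (a @ c) (a @ d)"
      using whisker_B[OF abcd(1) Nil, of g' c d] by simp
    from lin_idealD(3)[OF lin_ideal_B ob Wf this] show ?thesis
      by (simp add: free_lincat_simps(4))
  qed
  then show "tens M a b c d f g \<in> cls (otens M a c) (otens M b d) ` B (otens M a c) (otens M b d)"
    unfolding f'(2) g'(2) tens_cls[OF abcd f'(1) g'(1)] free_moncat_simps(5) by (rule imageI)
qed

text \<open>It suffices to treat the generators of \<open>B\<close>. The interchange relations vanish in \<open>M\<close>, and the class of a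
  whiskered relation is \<open>1\<^sub>a \<otimes> (\<rho> \<otimes> 1\<^sub>b)\<close>, which lies in every tensor ideal that contains \<open>\<rho>\<close>.\<close>

lemma cls_B_in_tensor_ideal:
  assumes T: "tensor_ideal K M T" and R: "\<And>x y. \<lbrakk>x \<in> lists X; y \<in> lists X\<rbrakk> \<Longrightarrow> R x y \<subseteq> T x y"
    and f: "f \<in> B x y"
  shows "cls x y f \<in> T x y"
proof (rule linear_functor_gen_ideal[OF linear_category_L linear_category_M linear_functor_cls _ _ f])
  show T_lin: "lin_ideal K M T" using T by (simp add: tensor_ideal_def)
  fix x y r assume "x \<in> obj L" "y \<in> obj L" and r: "r \<in> bar_rels K Q R rep x y"
  then have xy: "x \<in> lists X" "y \<in> lists X" by (simp_all only: obj_L)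
  have tens: "tens M a b c d g h \<in> T (a @ c) (b @ d)"
    if "a \<in> lists X" "b \<in> lists X" "c \<in> lists X" "d \<in> lists X" "g \<in> mor M a b" "h \<in> mor M c d"
      "g \<in> T a b \<or> h \<in> T c d" for a b c d g h
    using T that unfolding tensor_ideal_def free_moncat_simps(5) obj_M by blast
  have "cls x y r \<in> T x y"
    using r unfolding bar_rels_def
  proof
    assume "r \<in> interchange_rels K Q x y"
    then have "r \<in> I x y"
      using gen_ideal_superset[of x L y "interchange_rels K Q" K] xy by (auto simp only: obj_L)
    then have "cls x y r = I x y"
      using quotient_module.coset_eq_zero_iff[OF quotient_module_I[OF xy]]
        interchange_rels_mor[OF xy \<open>r \<in> interchange_rels K Q x y\<close>] by simp
    also have "\<dots> = \<zero>\<^bsub>homs M x y\<^esub>"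
      by (simp only: free_moncat_simps lincat_quot_simps quot_module_simps)
    also have "\<dots> \<in> T x y"
      using subgroup.one_closed[OF submodule.axioms(1)[OF lin_idealD(1)[OF T_lin, of x y]]] xy obj_M
      by simp
    finally show ?thesis .
  next
    assume "r \<in> whiskered_rels K Q R rep x y"
    then show ?thesis
    proof (rule whiskered_relsE)
      fix a b u v \<rho>
      assume ab: "a \<in> lists X" "b \<in> lists X" and uv: "u \<in> lists X" "v \<in> lists X" "\<rho> \<in> R u v"
        and x: "x = a @ u @ b" and y: "y = a @ v @ b" and r: "r = whisker K a b (rep u v \<rho>)"
      let ?r = "rep u v \<rho>" and ?e = "basis_elem K []"
      have Nil: "[] \<in> lists X" by simp
      have id: "?e \<in> mor L c c" if "c \<in> lists X" for c
        using L.ident_closed[of c] that by (simp add: obj_L free_lincat_simps(3))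
      have idM: "cls c c ?e \<in> mor M c c" if "c \<in> lists X" for c
        using id[OF that] by (simp add: mor_M)
      have ub: "u @ b \<in> lists X" "v @ b \<in> lists X" using uv ab by simp_all
      note rm = rep_mor[OF uv]
      have Wr: "whisker K [] b ?r \<in> mor L (u @ b) (v @ b)"
        using whisker_mor[OF Nil ab(2) uv(1,2) rm] by simp
      have "cls u v ?r \<in> T u v" using R[OF uv(1,2)] uv(3) cls_rep[OF uv] by auto
      then have "tens M u v b b (cls u v ?r) (cls b b ?e) \<in> T (u @ b) (v @ b)"
        using tens[OF uv(1,2) ab(2) ab(2) _ idM[OF ab(2)]] rm by (simp add: mor_M)
      also have "tens M u v b b (cls u v ?r) (cls b b ?e) = cls (u @ b) (v @ b) (whisker K [] b ?r)"
        unfolding tens_cls[OF uv(1,2) ab(2) ab(2) rm id[OF ab(2)]]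
        using conv_ident(2)[OF Wr[unfolded free_lincat_simps]] by (simp add: whisker_basis_elem)
      finally have rb: "cls (u @ b) (v @ b) (whisker K [] b ?r) \<in> T (u @ b) (v @ b)" .
      then have "tens M a a (u @ b) (v @ b) (cls a a ?e) (cls (u @ b) (v @ b) (whisker K [] b ?r))
          \<in> T (a @ u @ b) (a @ v @ b)"
        using tens[OF ab(1) ab(1) ub idM[OF ab(1)]] Wr by (simp add: mor_M)
      also have "tens M a a (u @ b) (v @ b) (cls a a ?e) (cls (u @ b) (v @ b) (whisker K [] b ?r))
          = cls (a @ u @ b) (a @ v @ b) (whisker K a b ?r)"
        unfolding tens_cls[OF ab(1) ab(1) ub id[OF ab(1)] Wr]
        using whisker_whisker[OF rm[unfolded free_lincat_simps], of a "[]" "[]" b]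
          conv_ident(1)[OF whisker_mor[OF ab uv(1,2) rm, unfolded free_lincat_simps]]
        by (simp add: whisker_basis_elem)
      finally show "cls x y r \<in> T x y" by (simp only: x y r)
    qed
  qed
  then show "r \<in> mor L x y \<and> cls x y r \<in> T x y"
    using bar_rels_mor[OF xy r] by simp
qed

abbreviation J where "J \<equiv> gen_tensor_ideal K M R"

lemma J_eq_image_B: "J = (\<lambda>x y. cls x y ` B x y)"
proof (intro ext equalityI)
  fix x y
  show "J x y \<subseteq> cls x y ` B x y"
  proof (rule gen_tensor_ideal_least[OF tensor_ideal_cls_B], rule subsetI)
    fix u v \<rho> assume "u \<in> obj M" "v \<in> obj M" and \<rho>: "\<rho> \<in> R u v"
    then have uv: "u \<in> lists X" "v \<in> lists X" by (simp_all only: obj_M)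
    have Nil: "[] \<in> lists X" by simp
    \<comment> \<open>The representative itself is the whiskered relation with trivial whiskers.\<close>
    have "whisker K [] [] (rep u v \<rho>) \<in> bar_rels K Q R rep u v"
      unfolding bar_rels_def by (intro UnI2 whiskered_relsI[OF Nil Nil uv \<rho>]) simp_all
    moreover have "whisker K [] [] (rep u v \<rho>) = rep u v \<rho>"
      using rep_mor[OF uv \<rho>] by (intro whisker_Nil) (simp add: free_lincat_simps free_module_closed)
    ultimately have "rep u v \<rho> \<in> B u v" using bar_rels_B[OF uv] by simp
    then have "cls u v (rep u v \<rho>) \<in> cls u v ` B u v" by (rule imageI)
    then show "\<rho> \<in> cls u v ` B u v" by (simp only: cls_rep[OF uv \<rho>])
  qed
  show "cls x y ` B x y \<subseteq> J x y"
  proof (intro image_subsetI gen_tensor_idealI)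
    fix f T assume "f \<in> B x y" "tensor_ideal K M T"
      and "\<And>x y. \<lbrakk>x \<in> obj M; y \<in> obj M\<rbrakk> \<Longrightarrow> R x y \<subseteq> T x y"
    then show "cls x y f \<in> T x y"
      by (intro cls_B_in_tensor_ideal) (simp_all only: obj_M)
  qed
qed

end

section \<open>Endomorphism algebras of a presented category\<close>

lemma linear_monoidal_iso_full_faithful:
  assumes C: "linear_category K C" and D: "linear_category K D"
    and F: "linear_monoidal_iso K C D Fo Fm" and ab: "a \<in> obj C" "b \<in> obj C"
  shows "Fm a b ` mor C a b = mor D (Fo a) (Fo b)"
    and "f \<in> mor C a b \<Longrightarrow> Fm a b f = \<zero>\<^bsub>homs D (Fo a) (Fo b)\<^esub> \<longleftrightarrow> f = \<zero>\<^bsub>homs C a b\<^esub>"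
proof -
  obtain Go Gm where G: "linear_functor K D C Go Gm"
    and GFo: "\<And>a. a \<in> obj C \<Longrightarrow> Go (Fo a) = a"
    and GFm: "\<And>a b f. \<lbrakk>a \<in> obj C; b \<in> obj C; f \<in> mor C a b\<rbrakk> \<Longrightarrow> Gm (Fo a) (Fo b) (Fm a b f) = f"
    and FGm: "\<And>x y h. \<lbrakk>x \<in> obj D; y \<in> obj D; h \<in> mor D x y\<rbrakk> \<Longrightarrow> Fm (Go x) (Go y) (Gm x y h) = h"
    using F unfolding linear_monoidal_iso_def linear_monoidal_functor_def by auto
  have F': "linear_functor K C D Fo Fm"
    using F unfolding linear_monoidal_iso_def linear_monoidal_functor_def by simp
  note FD = linear_functorD[OF F'] and GD = linear_functorD[OF G]
  note Fab = FD(1)[OF ab(1)] FD(1)[OF ab(2)]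
  show "Fm a b ` mor C a b = mor D (Fo a) (Fo b)"
  proof
    show "Fm a b ` mor C a b \<subseteq> mor D (Fo a) (Fo b)" using FD(2)[OF ab] by auto
    show "mor D (Fo a) (Fo b) \<subseteq> Fm a b ` mor C a b"
    proof
      fix h assume h: "h \<in> mor D (Fo a) (Fo b)"
      have "h = Fm a b (Gm (Fo a) (Fo b) h)" using FGm[OF Fab h] GFo ab by simp
      moreover have "Gm (Fo a) (Fo b) h \<in> mor C a b" using GD(2)[OF Fab h] GFo ab by simp
      ultimately show "h \<in> Fm a b ` mor C a b" by (rule image_eqI)
    qed
  qed
  show "Fm a b f = \<zero>\<^bsub>homs D (Fo a) (Fo b)\<^esub> \<longleftrightarrow> f = \<zero>\<^bsub>homs C a b\<^esub>" if f: "f \<in> mor C a b"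
  proof
    assume "Fm a b f = \<zero>\<^bsub>homs D (Fo a) (Fo b)\<^esub>"
    then have "f = Gm (Fo a) (Fo b) \<zero>\<^bsub>homs D (Fo a) (Fo b)\<^esub>" using GFm[OF ab f] by simp
    also have "\<dots> = \<zero>\<^bsub>homs C a b\<^esub>"
      using linear_functor_zero_minus(1)[OF D C G Fab] GFo ab by simp
    finally show "f = \<zero>\<^bsub>homs C a b\<^esub>" .
  next
    assume "f = \<zero>\<^bsub>homs C a b\<^esub>"
    then show "Fm a b f = \<zero>\<^bsub>homs D (Fo a) (Fo b)\<^esub>"
      using linear_functor_zero_minus(1)[OF C D F' ab] by simp
  qed
qed

context monoidal_relations
begin

text \<open>A morphism \<open>f\<close> of \<open>L\<close> becomes zero in \<open>D\<close> iff its class in \<open>M\<close> lies in \<open>J\<close>, that is, iff \<open>f\<close> is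
  congruent modulo \<open>I\<close> to an element of \<open>B\<close>. This means \<open>f \<in> B\<close>, because \<open>I\<close> is contained in \<open>B\<close>.\<close>

lemma End_alg_iso_quot_B:
  fixes D :: "('o, 'k, 'm, 'z) moncat_scheme"
  assumes D: "linear_category K D" and F: "linear_monoidal_iso K (moncat_quot M J) D Fo Fm"
    and a: "a \<in> lists X"
  shows "algebra_iso K (End_alg D (Fo a)) (quot_module (End_alg L a) (B a a)) \<noteq> {}"
proof -
  have J: "lin_ideal K M J"
    using tensor_ideal_cls_B unfolding J_eq_image_B tensor_ideal_def by simp
  let ?MJ = "moncat_quot M J"
  let ?jcls = "\<lambda>x y u. J x y +>\<^bsub>homs M x y\<^esub> u"
  have MJ: "linear_category K ?MJ"
    by (rule linear_category_cong[OF M.linear_category_quot[OF J]]) (simp_all only: moncat_quot_simps)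
  have jcls: "linear_functor K M ?MJ (\<lambda>x. x) ?jcls"
    by (rule linear_functor_cong[OF M.linear_functor_quot[OF J]]) (simp_all only: moncat_quot_simps)
  have F': "linear_functor K ?MJ D Fo Fm"
    using F unfolding linear_monoidal_iso_def linear_monoidal_functor_def by simp
  note T = linear_functor_comp[OF linear_functor_comp[OF linear_functor_cls jcls] F']
  have aL: "a \<in> obj L" and aM: "a \<in> obj M" and aMJ: "a \<in> obj ?MJ"
    using a by (simp_all only: obj_L obj_M moncat_quot_simps lincat_quot_simps)
  have mor_MJ: "mor ?MJ a a = ?jcls a a ` mor M a a" and zero_MJ: "\<zero>\<^bsub>homs ?MJ a a\<^esub> = J a a"
    by (simp_all only: moncat_quot_simps lincat_quot_simps quot_module_simps)
  note iso = linear_monoidal_iso_full_faithful[OF MJ D F aMJ aMJ]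
  interpret I: quotient_module K "homs L a a" "I a a" by (rule quotient_module_I[OF a a])
  interpret J: quotient_module K "homs M a a" "J a a" by (rule M.quotient_module_homs[OF J aM aM])
  interpret B: quotient_module K "homs L a a" "B a a" by (rule L.quotient_module_homs[OF lin_ideal_B aL aL])
  show ?thesis
  proof (rule End_alg_quot_iso[OF linear_category_L D T aL lin_ideal_B])
    have "(\<lambda>f. Fm a a (?jcls a a (cls a a f))) ` mor L a a = Fm a a ` ?jcls a a ` cls a a ` mor L a a"
      by (simp add: image_image)
    also have "\<dots> = mor D (Fo a) (Fo a)"
      by (simp only: mor_M[symmetric] mor_MJ[symmetric] iso(1))
    finally show "(\<lambda>f. Fm a a (?jcls a a (cls a a f))) ` mor L a a = mor D (Fo a) (Fo a)" .
  next
    fix f assume f: "f \<in> mor L a a"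
    then have cf: "cls a a f \<in> mor M a a" by (simp add: mor_M)
    have "cls a a f \<in> cls a a ` B a a \<longleftrightarrow> f \<in> B a a"
    proof
      assume "cls a a f \<in> cls a a ` B a a"
      then obtain g where g: "g \<in> B a a" "cls a a f = cls a a g" by auto
      have gm: "g \<in> mor L a a" using B.N.a_subset g(1) by auto
      have "f \<ominus>\<^bsub>homs L a a\<^esub> g \<in> B a a"
        using g(2) I.coset_eq_iff[OF f gm] I_subset_B by auto
      then have "B a a +>\<^bsub>homs L a a\<^esub> f = B a a +>\<^bsub>homs L a a\<^esub> g"
        using B.coset_eq_iff[OF f gm] by simp
      also have "\<dots> = B a a" using B.coset_eq_zero_iff[OF gm] g(1) by simp
      finally show "f \<in> B a a" using B.coset_eq_zero_iff[OF f] by simp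
    qed (rule imageI)
    moreover have "Fm a a (?jcls a a (cls a a f)) = \<zero>\<^bsub>homs D (Fo a) (Fo a)\<^esub> \<longleftrightarrow> ?jcls a a (cls a a f) = J a a"
      using iso(2)[of "?jcls a a (cls a a f)"] cf by (simp only: mor_MJ zero_MJ imageI)
    moreover have "?jcls a a (cls a a f) = J a a \<longleftrightarrow> cls a a f \<in> cls a a ` B a a"
      unfolding J.coset_eq_zero_iff[OF cf] by (simp only: J_eq_image_B)
    ultimately show "Fm a a (?jcls a a (cls a a f)) = \<zero>\<^bsub>homs D (Fo a) (Fo a)\<^esub> \<longleftrightarrow> f \<in> B a a"
      by simp
  qed
qed

end

lemma cas_loops_iff:
  assumes "\<And>e. e \<in> set p \<Longrightarrow> tail Q e = head Q e"
  shows "pre_digraph.cas Q a p b \<longleftrightarrow> a = b \<and> (\<forall>e\<in>set p. tail Q e = a)"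
  using assms by (induction p arbitrary: a) (auto simp: pre_digraph.cas.simps)

text \<open>If every edge is a loop, a path stays at its starting vertex, and it is an arbitrary word in the
  loops there.\<close>

lemma paths_loops:
  assumes loops: "\<And>e. e \<in> arcs Q \<Longrightarrow> tail Q e = head Q e" and a: "a \<in> verts Q"
  shows "paths Q a b = (if a = b then lists (endo_arcs Q a) else {})"
proof -
  have endo: "e \<in> endo_arcs Q a \<longleftrightarrow> e \<in> arcs Q \<and> tail Q e = a" for e
    unfolding endo_arcs_def mem_Collect_eq using loops by metis
  have "p \<in> paths Q a b \<longleftrightarrow> a = b \<and> p \<in> lists (endo_arcs Q a)" for p
  proof -
    have "p \<in> paths Q a b \<longleftrightarrow> set p \<subseteq> arcs Q \<and> pre_digraph.cas Q a (rev p) b"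
      using a by (simp add: paths_def pre_digraph.awalk_def)
    also have "\<dots> \<longleftrightarrow> set p \<subseteq> arcs Q \<and> a = b \<and> (\<forall>e\<in>set p. tail Q e = a)"
      using cas_loops_iff[of "rev p" Q a b] loops by (metis set_rev subsetD)
    also have "\<dots> \<longleftrightarrow> a = b \<and> p \<in> lists (endo_arcs Q a)"
      by (auto simp: in_lists_conv_set endo)
    finally show ?thesis .
  qed
  then show ?thesis by (simp add: set_eq_iff)
qed

theorem theorem5p4:
  fixes K :: "('k, 'y) ring_scheme"
    and D :: "('o, 'k, 'm, 'z) moncat_scheme"
    and X :: "'x set"
    and Q :: "('x list, 'e) pre_digraph"
    and R :: "('x list, (('x, 'e) bar_edge list \<Rightarrow> 'k) set) mor_family"
    and rep :: "'x list \<Rightarrow> 'x list \<Rightarrow> (('x, 'e) bar_edge list \<Rightarrow> 'k) set \<Rightarrow>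
                ('x, 'e) bar_edge list \<Rightarrow> 'k"
    and Fo :: "'x list \<Rightarrow> 'o"
    and Fm :: "'x list \<Rightarrow> 'x list \<Rightarrow> (('x, 'e) bar_edge list \<Rightarrow> 'k) set set \<Rightarrow> 'm"
    and a :: "'x list"
  assumes "cring K"
    and "linear_monoidal_category K D"
    and "monoidal_presentation K D X Q R Fo Fm"
    and "\<And>e. e \<in> arcs Q \<Longrightarrow> tail Q e = head Q e"
    and "\<And>x y \<rho>. \<lbrakk>x \<in> lists X; y \<in> lists X; \<rho> \<in> R x y\<rbrakk> \<Longrightarrow>
           rep x y \<rho> \<in> mor (free_lincat K (bar_quiver Q)) x y \<and> mor_class K Q x y (rep x y \<rho>) = \<rho>"
    and "a \<in> lists X"
  shows "algebra_iso K (End_alg D (Fo a))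
           (presented_algebra K (endo_arcs (bar_quiver Q) a) (bar_rels K Q R rep a a)) \<noteq> {}"
proof -
  note pres = assms(3)[unfolded monoidal_presentation_def]
  interpret free_monoid_quiver K Q X
    using assms(1) pres by (intro free_monoid_quiver.intro free_monoid_quiver_axioms.intro) simp_all
  interpret monoidal_relations K Q X R rep
    using assms(5) by unfold_locales (simp_all add: mor_class_def)
  have aL: "a \<in> obj L" using assms(6) by (simp only: obj_L)
  have loops: "tail (bar_quiver Q) \<alpha> = head (bar_quiver Q) \<alpha>" if "\<alpha> \<in> arcs (bar_quiver Q)" for \<alpha>
    using that assms(4) by auto
  have paths: "paths (bar_quiver Q) x y = (if x = y then lists (endo_arcs (bar_quiver Q) x) else {})"
    if "x \<in> verts Q" for x y
    using that loops by (intro paths_loops) simp_all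
  have "free_algebra K (endo_arcs (bar_quiver Q) a) = End_alg L a"
    using aL by (simp add: free_algebra_def End_alg_def free_lincat_def paths verts_Q)
  moreover have "B a a = Idl\<^bsub>End_alg L a\<^esub> (bar_rels K Q R rep a a)"
  proof (rule L.gen_ideal_End_alg[OF aL])
    show "bar_rels K Q R rep x y \<subseteq> mor L x y" if "x \<in> obj L" "y \<in> obj L" for x y
      using that by (auto simp only: obj_L intro: bar_rels_mor)
    show "mor L x y = {\<zero>\<^bsub>homs L x y\<^esub>}" if "x \<in> obj L" "y \<in> obj L" "x \<noteq> y" for x y
      using that by (auto simp: free_lincat_simps paths free_module_simps mem_free_module)
  qed
  moreover have "algebra_iso K (End_alg D (Fo a)) (quot_module (End_alg L a) (B a a)) \<noteq> {}"
  proof (rule End_alg_iso_quot_B[OF _ _ assms(6)])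
    show "linear_category K D"
      using assms(2) by (rule linear_monoidal_category.axioms(1))
    show "linear_monoidal_iso K (moncat_quot M J) D Fo Fm"
      using pres by simp
  qed
  ultimately show ?thesis by (simp add: presented_algebra_def)
qed

end
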